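(* Let $n\ge3$. There exists a bounded open convex set $K\subset\mathbb{R}^n$, with nonempty interior, such that $$\sup_{E}\mathcal{F}(E)=\mathcal{F}(K),$$ where the supremum is taken over all nonempty open, bounded, convex sets $E\subset\mathbb{R}^n$.
   Context: For a nonempty open bounded convex set $E\subset\mathbb{R}^n$, with Lebesgue measure $|E|$ and perimeter $P(E)=\mathcal{H}^{n-1}(\partial E)$, $$\mathcal{F}(E)=\frac{|E|^{(n-2)(n+1)}}{P(E)^{n^2-1}}\inf_{x_0\in\mathbb{R}^n}\int_{\partial E}|x-x_0|^2\,d\mathcal{H}^{n-1}.$$ *)

theory Defs
  imports "HOL-Analysis.Analysis"
begin

section \<open>Hausdorff measure\<close>

text \<open>
  Covers consist of bounded sets because \<^const>\<open>diameter\<close> is a junk value on unbounded ones.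
  Empty covering sets contribute \<open>0\<close>, which matters only for \<open>k = 0\<close>, where \<open>0 ^ 0 = 1\<close>.
  The normalisation is the usual one, making the \<open>n\<close>-dimensional Hausdorff measure on
  \<open>n\<close>-dimensional Euclidean space agree with Lebesgue measure.
\<close>

definition hausdorff_weight :: "nat \<Rightarrow> 'a::metric_space set \<Rightarrow> ennreal" where
  "hausdorff_weight k C =
     (if C = {} then 0 else ennreal (unit_ball_vol (real k) * (diameter C / 2) ^ k))"

definition hausdorff_pre :: "nat \<Rightarrow> real \<Rightarrow> 'a::metric_space set \<Rightarrow> ennreal" where
  "hausdorff_pre k \<delta> A =
     (INF C \<in> {C :: nat \<Rightarrow> 'a set. A \<subseteq> (\<Union>i. C i) \<and> (\<forall>i. bounded (C i) \<and> diameter (C i) \<le> \<delta>)}.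
        \<Sum>i. hausdorff_weight k (C i))"

definition hausdorff_outer :: "nat \<Rightarrow> 'a::metric_space set \<Rightarrow> ennreal" where
  "hausdorff_outer k A = (SUP \<delta> \<in> {0<..}. hausdorff_pre k \<delta> A)"

text \<open>
  \<^const>\<open>measure_of\<close> yields the zero measure if the given set function is not
  countably additive on the sigma algebra; \<open>emeasure_hausdorff_measure\<close> below
  shows that this does not happen here.
\<close>

definition hausdorff_measure :: "nat \<Rightarrow> 'a::metric_space measure" where
  "hausdorff_measure k = measure_of UNIV (sets borel) (hausdorff_outer k)"

lemma space_hausdorff_measure [simp]: "space (hausdorff_measure k) = UNIV"
  by (simp add: hausdorff_measure_def space_measure_of_conv)

lemma sets_hausdorff_measure [simp, measurable_cong]: "sets (hausdorff_measure k) = sets borel"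
  unfolding hausdorff_measure_def
  by (metis sets.sets_measure_of_eq space_borel)

lemma hausdorff_pre_le:
  assumes "A \<subseteq> (\<Union>i. C i)" "\<And>i. bounded (C i)" "\<And>i. diameter (C i) \<le> \<delta>"
  shows "hausdorff_pre k \<delta> A \<le> (\<Sum>i. hausdorff_weight k (C i))"
  unfolding hausdorff_pre_def by (rule INF_lower) (use assms in auto)

lemma hausdorff_pre_mono: "A \<subseteq> B \<Longrightarrow> hausdorff_pre k \<delta> A \<le> hausdorff_pre k \<delta> B"
  unfolding hausdorff_pre_def by (rule INF_superset_mono) auto

lemma hausdorff_pre_antimono: "\<delta> \<le> \<delta>' \<Longrightarrow> hausdorff_pre k \<delta>' A \<le> hausdorff_pre k \<delta> A"
  unfolding hausdorff_pre_def by (rule INF_superset_mono) (auto intro: order_trans)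

lemma hausdorff_pre_empty: "\<delta> > 0 \<Longrightarrow> hausdorff_pre k \<delta> {} = 0"
  using hausdorff_pre_le[of "{}" "\<lambda>_. {}" \<delta> k] by (simp add: hausdorff_weight_def)

lemma hausdorff_pre_UN_le:
  fixes A :: "nat \<Rightarrow> 'a::metric_space set"
  shows "hausdorff_pre k \<delta> (\<Union>i. A i) \<le> (\<Sum>i. hausdorff_pre k \<delta> (A i))" (is "_ \<le> ?S")
proof (rule ennreal_le_epsilon)
  fix e :: real assume fin: "?S < top" and e: "e > 0"
  have finA: "hausdorff_pre k \<delta> (A i) \<noteq> top" for i
    using ennreal_suminf_lessD[OF fin] by (metis less_irrefl)
  have "\<exists>C. A i \<subseteq> (\<Union>j. C j) \<and> (\<forall>j. bounded (C j) \<and> diameter (C j) \<le> \<delta>) \<and>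
          (\<Sum>j. hausdorff_weight k (C j)) < hausdorff_pre k \<delta> (A i) + ennreal (e * (1/2) ^ Suc i)" for i
  proof -
    have "0 < e * (1/2) ^ Suc i" using e by simp
    moreover have "hausdorff_pre k \<delta> (A i) \<noteq> \<infinity>" using finA by simp
    ultimately show ?thesis
      using INF_approx_ennreal[OF _ hausdorff_pre_def[of k \<delta> "A i"]] by fastforce
  qed
  then obtain C where C: "\<And>i. A i \<subseteq> (\<Union>j. C i j)" "\<And>i j. bounded (C i j)" "\<And>i j. diameter (C i j) \<le> \<delta>"
    and Cle: "\<And>i. (\<Sum>j. hausdorff_weight k (C i j)) < hausdorff_pre k \<delta> (A i) + ennreal (e * (1/2) ^ Suc i)"
    by metis
  define f where "f = (\<lambda>(i, j). hausdorff_weight k (C i j))"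
  define D where "D = (\<lambda>n. C (fst (prod_decode n)) (snd (prod_decode n)))"
  have "(\<Union>i. A i) \<subseteq> (\<Union>n. D n)"
  proof
    fix x assume "x \<in> (\<Union>i. A i)"
    then obtain i j where "x \<in> C i j" using C(1) by blast
    then have "x \<in> D (prod_encode (i, j))" by (simp add: D_def)
    then show "x \<in> (\<Union>n. D n)" by blast
  qed
  then have "hausdorff_pre k \<delta> (\<Union>i. A i) \<le> (\<Sum>n. hausdorff_weight k (D n))"
    by (rule hausdorff_pre_le) (auto simp: D_def C)
  also have "\<dots> = (\<Sum>n. f (prod_decode n))"
    by (simp add: f_def D_def case_prod_beta)
  also have "\<dots> = (\<Sum>i. \<Sum>j. f (i, j))"
    by (rule suminf_ennreal_2dimen) simp
  also have "\<dots> \<le> (\<Sum>i. hausdorff_pre k \<delta> (A i) + ennreal (e * (1/2) ^ Suc i))"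
    using Cle by (intro suminf_le) (auto simp: f_def intro: less_imp_le)
  also have "\<dots> = ?S + (\<Sum>i. ennreal (e * (1/2) ^ Suc i))"
    by (intro suminf_add[symmetric]) auto
  also have "(\<Sum>i. ennreal (e * (1/2) ^ Suc i)) = ennreal e"
  proof (rule suminf_ennreal_eq)
    show "(\<lambda>i. e * (1/2) ^ Suc i) sums e"
      using sums_mult[OF power_half_series, of e] by simp
  qed (use e in auto)
  finally show "hausdorff_pre k \<delta> (\<Union>i. A i) \<le> ?S + ennreal e" .
qed

lemma hausdorff_outer_mono: "A \<subseteq> B \<Longrightarrow> hausdorff_outer k A \<le> hausdorff_outer k B"
  unfolding hausdorff_outer_def by (intro SUP_mono) (blast intro: hausdorff_pre_mono)

lemma hausdorff_outer_empty [simp]: "hausdorff_outer k {} = 0"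
  unfolding hausdorff_outer_def
  by (auto simp: hausdorff_pre_empty bot_ennreal[symmetric] intro!: antisym SUP_least)

lemma hausdorff_outer_UN_le:
  fixes A :: "nat \<Rightarrow> 'a::metric_space set"
  shows "hausdorff_outer k (\<Union>i. A i) \<le> (\<Sum>i. hausdorff_outer k (A i))"
proof -
  have "hausdorff_pre k \<delta> (\<Union>i. A i) \<le> (\<Sum>i. hausdorff_outer k (A i))" if "\<delta> > 0" for \<delta>
  proof -
    have "hausdorff_pre k \<delta> (A i) \<le> hausdorff_outer k (A i)" for i
      unfolding hausdorff_outer_def by (rule SUP_upper) (use that in auto)
    then show ?thesis
      by (intro order_trans[OF hausdorff_pre_UN_le] suminf_le) auto
  qed
  then show ?thesis
    unfolding hausdorff_outer_def[of k "\<Union>i. A i"] by (intro SUP_least) auto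
qed

lemma outer_measure_space_hausdorff: "outer_measure_space UNIV (hausdorff_outer k)"
  unfolding outer_measure_space_def positive_def increasing_def countably_subadditive_def
  by (auto intro: hausdorff_outer_mono hausdorff_outer_UN_le)

lemma hausdorff_outer_Un_le: "hausdorff_outer k (A \<union> B) \<le> hausdorff_outer k A + hausdorff_outer k B"
proof -
  have "algebra UNIV (UNIV :: 'a set set)"
    by (simp add: algebra_iff_Un)
  then interpret algebra UNIV "UNIV :: 'a set set" .
  have "subadditive (UNIV :: 'a set set) (hausdorff_outer k)"
    using outer_measure_space_hausdorff[of k] countably_subadditive_subadditive
    unfolding outer_measure_space_def by blast
  then have "hausdorff_outer k (A \<union> (B - A)) \<le> hausdorff_outer k A + hausdorff_outer k (B - A)"
    by (rule subadditiveD) auto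
  also have "\<dots> \<le> hausdorff_outer k A + hausdorff_outer k B"
    by (intro add_left_mono hausdorff_outer_mono) auto
  finally show ?thesis by simp
qed

lemma hausdorff_outer_separated:
  fixes A B :: "'a::metric_space set"
  assumes d: "d > 0" and sep: "\<And>a b. a \<in> A \<Longrightarrow> b \<in> B \<Longrightarrow> d \<le> dist a b"
  shows "hausdorff_outer k A + hausdorff_outer k B \<le> hausdorff_outer k (A \<union> B)"
proof -
  have pre: "hausdorff_pre k \<delta> A + hausdorff_pre k \<delta> B \<le> hausdorff_pre k \<delta> (A \<union> B)"
    if \<delta>: "0 < \<delta>" "\<delta> < d" for \<delta>
    unfolding hausdorff_pre_def[of k \<delta> "A \<union> B"]
  proof (rule INF_greatest, clarify)
    fix C :: "nat \<Rightarrow> 'a set"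
    assume cov: "A \<union> B \<subseteq> (\<Union>i. C i)" and C: "\<forall>i. bounded (C i) \<and> diameter (C i) \<le> \<delta>"
    define D where "D = (\<lambda>X i. if C i \<inter> X = {} then {} else C i)"
    have D: "hausdorff_pre k \<delta> X \<le> (\<Sum>i. hausdorff_weight k (D X i))" if XAB: "X \<subseteq> A \<union> B" for X
    proof (rule hausdorff_pre_le)
      show "X \<subseteq> (\<Union>i. D X i)"
      proof
        fix x assume x: "x \<in> X"
        then obtain i where "x \<in> C i" using XAB cov by blast
        with x have "x \<in> D X i" by (auto simp: D_def)
        then show "x \<in> (\<Union>i. D X i)" by blast
      qed
    qed (use C \<delta> in \<open>auto simp: D_def\<close>)
    have le: "hausdorff_weight k (D A i) + hausdorff_weight k (D B i) \<le> hausdorff_weight k (C i)" for i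
    proof -
      have "C i \<inter> A = {} \<or> C i \<inter> B = {}"
      proof (rule ccontr)
        assume "\<not> ?thesis"
        then obtain a b where ab: "a \<in> C i" "a \<in> A" "b \<in> C i" "b \<in> B" by blast
        then have "dist a b \<le> \<delta>" using C diameter_bounded_bound by (meson order_trans)
        with sep[of a b] ab \<delta> show False by simp
      qed
      then show ?thesis by (auto simp: D_def hausdorff_weight_def)
    qed
    have "hausdorff_pre k \<delta> A + hausdorff_pre k \<delta> B
        \<le> (\<Sum>i. hausdorff_weight k (D A i)) + (\<Sum>i. hausdorff_weight k (D B i))"
      by (intro add_mono D) auto
    also have "\<dots> = (\<Sum>i. hausdorff_weight k (D A i) + hausdorff_weight k (D B i))"
      by (rule suminf_add) auto
    also have "\<dots> \<le> (\<Sum>i. hausdorff_weight k (C i))"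
      by (intro suminf_le le) auto
    finally show "hausdorff_pre k \<delta> A + hausdorff_pre k \<delta> B \<le> (\<Sum>i. hausdorff_weight k (C i))" .
  qed
  have *: "hausdorff_pre k \<delta> A + hausdorff_pre k \<delta>' B \<le> hausdorff_outer k (A \<union> B)"
    if "\<delta> > 0" "\<delta>' > 0" for \<delta> \<delta>'
  proof -
    define m where "m = min (min \<delta> \<delta>') (d / 2)"
    have m: "0 < m" "m < d" "m \<le> \<delta>" "m \<le> \<delta>'" using that d by (auto simp: m_def)
    have "hausdorff_pre k \<delta> A + hausdorff_pre k \<delta>' B \<le> hausdorff_pre k m A + hausdorff_pre k m B"
      using m by (intro add_mono hausdorff_pre_antimono)
    also have "\<dots> \<le> hausdorff_pre k m (A \<union> B)" using m by (intro pre)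
    also have "\<dots> \<le> hausdorff_outer k (A \<union> B)"
      unfolding hausdorff_outer_def by (rule SUP_upper) (use m in auto)
    finally show ?thesis .
  qed
  have ne: "{0 :: real <..} \<noteq> {}" by simp
  have "hausdorff_pre k \<delta> A + hausdorff_outer k B \<le> hausdorff_outer k (A \<union> B)" if "\<delta> > 0" for \<delta>
  proof -
    have "hausdorff_pre k \<delta> A + hausdorff_outer k B
        = (SUP \<delta>' \<in> {0<..}. hausdorff_pre k \<delta> A + hausdorff_pre k \<delta>' B)"
      unfolding hausdorff_outer_def[of k B] by (rule ennreal_SUP_add_right[OF ne])
    also have "\<dots> \<le> hausdorff_outer k (A \<union> B)"
      using * that by (intro SUP_least) auto
    finally show ?thesis .
  qed
  then show ?thesis
    unfolding hausdorff_outer_def[of k A] ennreal_SUP_add_left[OF ne, symmetric]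
    by (intro SUP_least) auto
qed

lemma closed_in_lambda_system_hausdorff:
  fixes F :: "'a::metric_space set"
  assumes F: "closed F"
  shows "F \<in> lambda_system UNIV UNIV (hausdorff_outer k)"
proof -
  let ?\<mu> = "hausdorff_outer k :: 'a set \<Rightarrow> ennreal"
  have "?\<mu> (F \<inter> A) + ?\<mu> (A - F) \<le> ?\<mu> A" for A
  proof (cases "F = {} \<or> ?\<mu> A = top")
    case False
    then have ne: "F \<noteq> {}" and fin: "?\<mu> A \<noteq> top" by auto
    define N where "N = (\<lambda>j::nat. {x \<in> A. 1 / real (Suc j) \<le> infdist x F})"
    define R where "R = (\<lambda>j. N (Suc j) - N j)"
    have N_mono: "N i \<subseteq> N j" if "i \<le> j" for i j
    proof -
      have "1 / real (Suc j) \<le> 1 / real (Suc i)" using that by (simp add: field_simps)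
      then show ?thesis unfolding N_def by (auto intro: order_trans)
    qed
    have N_UN: "A - F \<subseteq> (\<Union>j. N j)"
    proof
      fix x assume x: "x \<in> A - F"
      then have "infdist x F > 0"
        using F ne by (simp add: infdist_pos_not_in_closed)
      then obtain j where "1 / real (Suc j) < infdist x F"
        using nat_approx_posE by blast
      then show "x \<in> (\<Union>j. N j)" using x by (auto simp: N_def intro!: exI[of _ j])
    qed
    have NA: "?\<mu> (N j) \<le> ?\<mu> A" for j by (rule hausdorff_outer_mono) (auto simp: N_def)
    have sepF: "?\<mu> (F \<inter> A) + ?\<mu> (N j) \<le> ?\<mu> A" for j
    proof -
      have "?\<mu> (F \<inter> A) + ?\<mu> (N j) \<le> ?\<mu> ((F \<inter> A) \<union> N j)"
      proof (rule hausdorff_outer_separated)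
        show "0 < 1 / real (Suc j)" by simp
        fix a b assume "a \<in> F \<inter> A" "b \<in> N j"
        then show "1 / real (Suc j) \<le> dist a b"
          using infdist_le[of a F b] by (auto simp: N_def dist_commute)
      qed
      also have "\<dots> \<le> ?\<mu> A" by (rule hausdorff_outer_mono) (auto simp: N_def)
      finally show ?thesis .
    qed
    have step: "?\<mu> (N j) + ?\<mu> (R (Suc j)) \<le> ?\<mu> (N (Suc (Suc j)))" for j
    proof -
      have "?\<mu> (N j) + ?\<mu> (R (Suc j)) \<le> ?\<mu> (N j \<union> R (Suc j))"
      proof (rule hausdorff_outer_separated)
        show "0 < 1 / real (Suc j) - 1 / real (Suc (Suc j))" 
          using frac_less2[of 1 1 "real (Suc j)" "real (Suc (Suc j))"] by simp
        fix a b assume ab: "a \<in> N j" "b \<in> R (Suc j)"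
        then have "infdist b F < 1 / real (Suc (Suc j))" by (auto simp: R_def N_def)
        moreover have "infdist a F \<le> infdist b F + dist a b" by (rule infdist_triangle)
        moreover have "1 / real (Suc j) \<le> infdist a F" using ab by (auto simp: N_def)
        ultimately show "1 / real (Suc j) - 1 / real (Suc (Suc j)) \<le> dist a b" by linarith
      qed
      also have "\<dots> \<le> ?\<mu> (N (Suc (Suc j)))"
        using N_mono[of j "Suc (Suc j)"] by (intro hausdorff_outer_mono) (auto simp: R_def)
      finally show ?thesis .
    qed
    have part: "(\<Sum>i<Suc n. ?\<mu> (R i)) \<le> ?\<mu> (N n) + ?\<mu> (N (Suc n))" for n
    proof (induction n)
      case 0
      have "?\<mu> (R 0) \<le> ?\<mu> (N (Suc 0))" by (rule hausdorff_outer_mono) (auto simp: R_def)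
      then show ?case by (simp add: add_increasing)
    next
      case (Suc n)
      have "(\<Sum>i<Suc (Suc n). ?\<mu> (R i)) \<le> (?\<mu> (N n) + ?\<mu> (N (Suc n))) + ?\<mu> (R (Suc n))"
        using add_right_mono[OF Suc.IH] by simp
      also have "\<dots> = ?\<mu> (N (Suc n)) + (?\<mu> (N n) + ?\<mu> (R (Suc n)))" by (simp add: ac_simps)
      also have "\<dots> \<le> ?\<mu> (N (Suc n)) + ?\<mu> (N (Suc (Suc n)))" by (intro add_left_mono step)
      finally show ?case .
    qed
    define S where "S = (\<Sum>i. ?\<mu> (R i))"
    have "S \<le> ?\<mu> A + ?\<mu> A"
      unfolding S_def
    proof (rule suminf_le_const)
      show "(\<Sum>i<n. ?\<mu> (R i)) \<le> ?\<mu> A + ?\<mu> A" for n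
        by (rule order_trans[OF sum_mono2 order_trans[OF part[of n] add_mono[OF NA NA]]]) auto
    qed simp
    with fin have S: "S \<noteq> top" by (auto simp: top_unique)
    have main: "(?\<mu> (F \<inter> A) + ?\<mu> (A - F)) + (\<Sum>i<j. ?\<mu> (R i)) \<le> ?\<mu> A + S" for j
    proof -
      have "A - F \<subseteq> N j \<union> (\<Union>i. R (i + j))"
      proof
        fix x assume "x \<in> A - F"
        then obtain m where m: "x \<in> N m" using N_UN by blast
        have "x \<in> N j \<union> (\<Union>i. R (i + j))" if "x \<in> N (i + j)" for i
          using that
        proof (induction i)
          case (Suc i)
          then show ?case by (cases "x \<in> N (i + j)") (auto simp: R_def)
        qed auto
        moreover have "x \<in> N (m + j)" using m N_mono[of m "m + j"] by auto
        ultimately show "x \<in> N j \<union> (\<Union>i. R (i + j))" by blast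
      qed
      then have "?\<mu> (A - F) \<le> ?\<mu> (N j) + (\<Sum>i. ?\<mu> (R (i + j)))"
        by (rule order_trans[OF hausdorff_outer_mono
              order_trans[OF hausdorff_outer_Un_le add_left_mono[OF hausdorff_outer_UN_le]]])
      then have "(?\<mu> (F \<inter> A) + ?\<mu> (A - F)) + (\<Sum>i<j. ?\<mu> (R i))
          \<le> (?\<mu> (F \<inter> A) + (?\<mu> (N j) + (\<Sum>i. ?\<mu> (R (i + j))))) + (\<Sum>i<j. ?\<mu> (R i))"
        by (intro add_mono) auto
      also have "\<dots> = (?\<mu> (F \<inter> A) + ?\<mu> (N j)) + S"
        unfolding S_def by (subst suminf_offset[of _ j]) (auto simp: ac_simps)
      also have "\<dots> \<le> ?\<mu> A + S" by (intro add_right_mono sepF)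
      finally show ?thesis .
    qed
    have "(?\<mu> (F \<inter> A) + ?\<mu> (A - F)) + S
        = (SUP j. (?\<mu> (F \<inter> A) + ?\<mu> (A - F)) + (\<Sum>i<j. ?\<mu> (R i)))"
      unfolding S_def suminf_eq_SUP by (rule ennreal_SUP_add_right) simp
    also have "\<dots> \<le> ?\<mu> A + S"
      by (intro SUP_least main)
    finally have "(?\<mu> (F \<inter> A) + ?\<mu> (A - F)) + S \<le> ?\<mu> A + S" .
    then have "S + (?\<mu> (F \<inter> A) + ?\<mu> (A - F)) \<le> S + ?\<mu> A"
      by (simp only: add.commute[of S])
    then have "S = \<infinity> \<or> ?\<mu> (F \<inter> A) + ?\<mu> (A - F) \<le> ?\<mu> A"
      by (simp only: ennreal_add_left_cancel_le)
    with S show ?thesis by (simp only: infinity_ennreal_def) blast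
  qed auto
  moreover have "?\<mu> A \<le> ?\<mu> (F \<inter> A) + ?\<mu> (A - F)" for A
    using hausdorff_outer_Un_le[of k "F \<inter> A" "A - F"] by (simp add: Int_Diff_Un Int_commute)
  moreover have "(UNIV - F) \<inter> A = A - F" for A by auto
  ultimately show ?thesis
    unfolding lambda_system_def by (auto intro: antisym)
qed

theorem emeasure_hausdorff_measure:
  fixes A :: "'a::metric_space set"
  assumes "A \<in> sets borel"
  shows "emeasure (hausdorff_measure k) A = hausdorff_outer k A"
proof -
  have "sigma_algebra UNIV (UNIV :: 'a set set)"
    using sigma_algebra_Pow[of "UNIV :: 'a set"] by simp
  then interpret P: sigma_algebra UNIV "UNIV :: 'a set set" .
  let ?L = "lambda_system UNIV UNIV (hausdorff_outer k) :: 'a set set"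
  have L: "measure_space UNIV ?L (hausdorff_outer k)"
    by (rule P.caratheodory_lemma[OF outer_measure_space_hausdorff])
  then have "sigma_algebra UNIV ?L" by (simp add: measure_space_def)
  then have sub: "sets (borel :: 'a measure) \<subseteq> ?L"
    unfolding borel_eq_closed
    using sigma_algebra.sigma_sets_subset[of UNIV ?L "Collect closed"]
      closed_in_lambda_system_hausdorff[where 'a = 'a] by auto
  show ?thesis
    unfolding hausdorff_measure_def
  proof (rule emeasure_measure_of_sigma)
    show "sigma_algebra UNIV (sets (borel :: 'a measure))"
      by (metis sets.sigma_algebra_axioms space_borel)
    show "positive (sets (borel :: 'a measure)) (hausdorff_outer k)"
      by (simp add: positive_def)
    show "countably_additive (sets (borel :: 'a measure)) (hausdorff_outer k)"
      using L sub unfolding measure_space_def countably_additive_def by (meson order_trans subsetD)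
  qed (use assms in simp)
qed


section \<open>The functional\<close>

definition perimeter :: "(real ^ 'n) set \<Rightarrow> ennreal" where
  "perimeter E = emeasure (hausdorff_measure (CARD('n) - 1)) (frontier E)"

text \<open>
  Values are taken in \<^typ>\<open>ennreal\<close>, so that neither the integral nor the supremum over all
  sets \<open>E\<close> needs a side condition ensuring that it is finite.
\<close>

definition shape_functional :: "(real ^ 'n) set \<Rightarrow> ennreal" where
  "shape_functional E =
     emeasure lborel E ^ ((CARD('n) - 2) * (CARD('n) + 1)) / perimeter E ^ (CARD('n)\<^sup>2 - 1)
     * (INF x\<^sub>0. \<integral>\<^sup>+x\<in>frontier E. ennreal ((norm (x - x\<^sub>0))\<^sup>2) \<partial>hausdorff_measure (CARD('n) - 1))"

end

theory Submission
  imports Defs "HOL-Complex_Analysis.Great_Picard"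
begin

text \<open>
  Write \<open>n\<close> for the dimension, \<open>P\<close> for the perimeter, \<open>F\<close> for the functional and \<open>M(E,x)\<close>
  for the moment integral \<open>\<integral> |y - x|\<^sup>2\<close> over the boundary of \<open>E\<close>. The proof is the direct
  method: a maximizing sequence is normalized, a subsequence converges to a convex body, and
  \<open>F\<close> is upper semicontinuous along it. Three points need an argument.

  \<^item> A single device gives all comparisons of boundary integrals. If
  \<open>E\<close> is contained in an image \<open>\<tau>(L)\<close> of \<open>L\<close> under a dilation \<open>\<tau>\<close> of ratio \<open>t\<close>, then \<open>\<tau>\<close>
  followed by the nearest-point projection onto \<open>E\<close> maps the boundary of \<open>L\<close> onto that
  of \<open>E\<close>, and it is \<open>t\<close>-Lipschitz; hence boundary integrals over \<open>E\<close> are at most \<open>t^(n-1)\<close>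
  times the pulled back integrals over \<open>L\<close> (\<open>nn_integral_frontier_le\<close>).

  \<^item> A maximizing sequence cannot flatten. Scale \<open>E\<close> into the unit ball with
  diameter bounded below; let \<open>\<rho>\<close> be its inradius. Since \<open>M(E,0) \<le> P\<close>,
  \<open>F(E) \<le> |E|^a / P^(b-1)\<close> with \<open>a = (n-2)(n+1)\<close> and \<open>b = n\<^sup>2-1\<close>. A convex body without a ball
  of radius \<open>2\<rho>\<close> has width at most \<open>2(n+1)\<rho>\<close> in some direction (\<open>inscribed_ball_or_thin\<close>,
  from Helly's theorem), so \<open>|E| \<le> C \<rho> P\<close> (\<open>emeasure_le_width_times_perimeter\<close>). The convex
  hull of a ball of radius comparable to \<open>\<rho>\<close> and a far point gives \<open>|E| \<ge> c \<rho>^(n-1)\<close>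
  (\<open>emeasure_ge_ball_and_point\<close>). Eliminating \<open>P\<close> and then \<open>|E|\<close> leaves
  \<open>F(E) \<le> C' \<rho>^(n-2)\<close>, which tends to \<open>0\<close> with \<open>\<rho>\<close> because \<open>n \<ge> 3\<close>. Thus a lower bound on \<open>F\<close>
  is a lower bound on the volume (\<open>volume_ge_if_shape_functional_ge\<close>), and the limit
  body has interior points.

  \<^item> Once the limit \<open>K\<close> contains a ball around \<open>z\<close>, Hausdorff convergence means that \<open>E\<^sub>k\<close> and
  \<open>K\<close> are eventually nested between dilates of each other about \<open>z\<close> with ratios close to \<open>1\<close>
  (\<open>eventually_between_dilates\<close>). The comparison device then bounds \<open>|E\<^sub>k|\<close> and
  \<open>M(E\<^sub>k,x)\<close> from above and \<open>P(E\<^sub>k)\<close> from below, which is all that upper semicontinuity needs.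

  Convergence comes from the Arzela--Ascoli theorem applied to the distance functions of
  the bodies.
\<close>


section \<open>Hausdorff measure under Lipschitz maps\<close>

lemma hausdorff_weight_Lipschitz_image:
  fixes f :: "'a::metric_space \<Rightarrow> 'b::metric_space"
  assumes L: "L > 0" and lip: "\<And>x y. x \<in> C \<Longrightarrow> y \<in> C \<Longrightarrow> dist (f x) (f y) \<le> L * dist x y"
    and C: "bounded C"
  shows "bounded (f ` C)" "diameter (f ` C) \<le> L * diameter C"
    "hausdorff_weight k (f ` C) \<le> ennreal (L ^ k) * hausdorff_weight k C"
proof -
  have d: "dist (f x) (f y) \<le> L * diameter C" if "x \<in> C" "y \<in> C" for x y
    using lip[OF that] diameter_bounded_bound[OF C that] L
    by (meson mult_left_mono order_trans less_imp_le)
  show "bounded (f ` C)"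
    using d unfolding bounded_two_points by blast
  show dia: "diameter (f ` C) \<le> L * diameter C"
    using d diameter_ge_0[OF C] L
    by (cases "C = {}") (auto simp: diameter_def intro!: cSUP_least)
  have "diameter (f ` C) \<ge> 0"
    using \<open>bounded (f ` C)\<close> by (rule diameter_ge_0)
  then have "(diameter (f ` C) / 2) ^ k \<le> (L * diameter C / 2) ^ k"
    by (intro power_mono divide_right_mono dia) auto
  also have "\<dots> = L ^ k * (diameter C / 2) ^ k"
    by (simp add: power_mult_distrib power_divide)
  finally have "unit_ball_vol (real k) * (diameter (f ` C) / 2) ^ k
      \<le> L ^ k * (unit_ball_vol (real k) * (diameter C / 2) ^ k)"
    by (simp add: mult.left_commute mult_left_mono)
  then show "hausdorff_weight k (f ` C) \<le> ennreal (L ^ k) * hausdorff_weight k C"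
    using L diameter_ge_0[OF C] by (auto simp: hausdorff_weight_def ennreal_mult[symmetric] ennreal_leI)
qed

lemma ennreal_le_mult_if_divide_le:
  assumes "r > 0" "x / ennreal r \<le> y"
  shows "x \<le> ennreal r * y"
proof -
  have "x = ennreal r * (x / ennreal r)"
    using assms(1) by (simp add: ennreal_times_divide mult.commute[of _ x] mult_divide_eq_ennreal)
  then show ?thesis using assms(2) by (metis mult_left_mono zero_le)
qed

lemma hausdorff_outer_Lipschitz_image:
  fixes f :: "'a::metric_space \<Rightarrow> 'b::metric_space"
  assumes L: "L > 0" and lip: "\<And>x y. x \<in> A \<Longrightarrow> y \<in> A \<Longrightarrow> dist (f x) (f y) \<le> L * dist x y"
  shows "hausdorff_outer k (f ` A) \<le> ennreal (L ^ k) * hausdorff_outer k A"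
proof -
  have pre: "hausdorff_pre k (L * \<delta>) (f ` A) \<le> ennreal (L ^ k) * hausdorff_pre k \<delta> A" for \<delta>
  proof -
    have "hausdorff_pre k (L * \<delta>) (f ` A) / ennreal (L ^ k) \<le> hausdorff_pre k \<delta> A"
      unfolding hausdorff_pre_def[of k \<delta> A]
    proof (rule INF_greatest, clarify)
      fix C :: "nat \<Rightarrow> 'a set"
      assume cov: "A \<subseteq> (\<Union>i. C i)" and C: "\<forall>i. bounded (C i) \<and> diameter (C i) \<le> \<delta>"
      define D where "D i = C i \<inter> A" for i
      have D: "bounded (D i)" "diameter (D i) \<le> diameter (C i)" for i
        using C by (auto simp: D_def intro: bounded_subset diameter_subset)
      have lipD: "dist (f x) (f y) \<le> L * dist x y" if "x \<in> D i" "y \<in> D i" for i x y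
        using that lip by (auto simp: D_def)
      have im: "bounded (f ` D i)" "diameter (f ` D i) \<le> L * diameter (D i)"
        "hausdorff_weight k (f ` D i) \<le> ennreal (L ^ k) * hausdorff_weight k (D i)" for i
        by (rule hausdorff_weight_Lipschitz_image[OF L lipD D(1)]; assumption)+
      have "hausdorff_pre k (L * \<delta>) (f ` A) \<le> (\<Sum>i. hausdorff_weight k (f ` D i))"
      proof (rule hausdorff_pre_le)
        show "f ` A \<subseteq> (\<Union>i. f ` D i)" using cov unfolding D_def by blast
        show "bounded (f ` D i)" for i using im(1) .
        show "diameter (f ` D i) \<le> L * \<delta>" for i
          using im(2)[of i] D(2)[of i] C L by (meson mult_left_mono order_trans less_imp_le)
      qed
      also have "\<dots> \<le> (\<Sum>i. ennreal (L ^ k) * hausdorff_weight k (C i))"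
      proof (intro suminf_le)
        fix i
        have "hausdorff_weight k (D i) \<le> hausdorff_weight k (C i)"
          using D diameter_ge_0[OF D(1)] by (auto simp: hausdorff_weight_def D_def intro!: ennreal_leI mult_left_mono power_mono divide_right_mono)
        then show "hausdorff_weight k (f ` D i) \<le> ennreal (L ^ k) * hausdorff_weight k (C i)"
          using im(3)[of i] by (meson mult_left_mono order_trans zero_le)
      qed auto
      also have "\<dots> = ennreal (L ^ k) * (\<Sum>i. hausdorff_weight k (C i))"
        by (rule ennreal_suminf_cmult)
      finally show "hausdorff_pre k (L * \<delta>) (f ` A) / ennreal (L ^ k) \<le> (\<Sum>i. hausdorff_weight k (C i))"
        using L by (intro divide_le_posI_ennreal) auto
    qed
    then show ?thesis
      using L by (intro ennreal_le_mult_if_divide_le) auto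
  qed
  show ?thesis
    unfolding hausdorff_outer_def[of k "f ` A"]
  proof (rule SUP_least)
    fix \<delta> :: real assume "\<delta> \<in> {0<..}"
    then have "hausdorff_pre k (\<delta> / L) A \<le> hausdorff_outer k A"
      unfolding hausdorff_outer_def using L by (intro SUP_upper) auto
    then show "hausdorff_pre k \<delta> (f ` A) \<le> ennreal (L ^ k) * hausdorff_outer k A"
      using pre[of "\<delta> / L"] L by (simp add: order_trans[OF _ mult_left_mono])
  qed
qed

text \<open>
  For indicator functions \<open>g\<close> this is the Lipschitz bound for the outer measure, applied to the
  part of \<open>A\<close> that is mapped into the given set; both sides are additive and commute with
  monotone limits in \<open>g\<close>. The outer measure is what makes images of Borel sets harmless here.
\<close>

lemma nn_integral_hausdorff_Lipschitz_image:
  fixes f :: "'a::metric_space \<Rightarrow> 'b::metric_space"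
  assumes L: "L > 0" and lip: "\<And>x y. dist (f x) (f y) \<le> L * dist x y"
    and A: "A \<in> sets borel" and B: "B \<in> sets borel" and BA: "B \<subseteq> f ` A"
    and g: "g \<in> borel_measurable borel"
  shows "(\<integral>\<^sup>+y\<in>B. g y \<partial>hausdorff_measure k)
    \<le> ennreal (L ^ k) * (\<integral>\<^sup>+x\<in>A. g (f x) \<partial>hausdorff_measure k)"
proof -
  have "continuous_on UNIV f"
    by (rule lipschitz_on_continuous_on[of L]) (use L lip in \<open>auto simp: lipschitz_on_def\<close>)
  then have f[measurable]: "f \<in> borel_measurable borel"
    by (rule borel_measurable_continuous_onI)
  note [measurable] = A B
  show ?thesis using g
  proof (induction g rule: borel_measurable_induct)
    case (cong g h)
    then show ?case by simp
  next
    case (set S)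
    then have [measurable]: "S \<in> sets borel" by simp
    have fS: "f -` S \<in> sets borel" using measurable_sets[OF f \<open>S \<in> sets borel\<close>] by simp
    have "(\<integral>\<^sup>+y\<in>B. indicator S y \<partial>hausdorff_measure k) = hausdorff_outer k (S \<inter> B)"
      by (simp add: indicator_inter_arith[symmetric] emeasure_hausdorff_measure)
    also have "\<dots> \<le> hausdorff_outer k (f ` (f -` S \<inter> A))"
      using BA by (intro hausdorff_outer_mono) auto
    also have "\<dots> \<le> ennreal (L ^ k) * hausdorff_outer k (f -` S \<inter> A)"
      using L lip by (intro hausdorff_outer_Lipschitz_image) auto
    also have "hausdorff_outer k (f -` S \<inter> A) = (\<integral>\<^sup>+x\<in>A. indicator (f -` S) x \<partial>hausdorff_measure k)"
      using fS by (simp add: indicator_inter_arith[symmetric] emeasure_hausdorff_measure)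
    also have "\<dots> = (\<integral>\<^sup>+x\<in>A. indicator S (f x) \<partial>hausdorff_measure k)"
      by (simp add: indicator_def)
    finally show ?case .
  next
    case (mult u c)
    then have [measurable]: "u \<in> borel_measurable borel" by simp
    have "(\<integral>\<^sup>+y\<in>B. c * u y \<partial>hausdorff_measure k) = c * (\<integral>\<^sup>+y\<in>B. u y \<partial>hausdorff_measure k)"
      by (simp add: mult.assoc nn_integral_cmult)
    also have "\<dots> \<le> c * (ennreal (L ^ k) * (\<integral>\<^sup>+x\<in>A. u (f x) \<partial>hausdorff_measure k))"
      by (intro mult_left_mono mult) auto
    also have "\<dots> = ennreal (L ^ k) * (c * (\<integral>\<^sup>+x\<in>A. u (f x) \<partial>hausdorff_measure k))"
      by (rule mult.left_commute)
    also have "c * (\<integral>\<^sup>+x\<in>A. u (f x) \<partial>hausdorff_measure k) = (\<integral>\<^sup>+x\<in>A. c * u (f x) \<partial>hausdorff_measure k)"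
      by (simp add: mult.assoc nn_integral_cmult)
    finally show ?case .
  next
    case (add u v)
    then have [measurable]: "u \<in> borel_measurable borel" "v \<in> borel_measurable borel" by simp_all
    show ?case
      using add by (simp add: distrib_right nn_integral_add distrib_left add_mono)
  next
    case (seq U)
    then have [measurable]: "\<And>i. U i \<in> borel_measurable borel" by simp
    have inc: "incseq (\<lambda>i x. U i (h x) * indicator X x)" for X and h :: "'c \<Rightarrow> 'b"
      using \<open>incseq U\<close> by (auto simp: incseq_def le_fun_def intro!: mult_right_mono)
    have "(\<integral>\<^sup>+y\<in>B. (SUP i. U i) y \<partial>hausdorff_measure k) = (SUP i. \<integral>\<^sup>+y\<in>B. U i y \<partial>hausdorff_measure k)"
      using inc[of "\<lambda>x. x" B] by (simp add: image_comp SUP_mult_right_ennreal nn_integral_monotone_convergence_SUP[symmetric])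
    also have "\<dots> \<le> (SUP i. ennreal (L ^ k) * (\<integral>\<^sup>+x\<in>A. U i (f x) \<partial>hausdorff_measure k))"
      by (intro SUP_mono) (use seq in auto)
    also have "\<dots> = ennreal (L ^ k) * (\<integral>\<^sup>+x\<in>A. (SUP i. U i) (f x) \<partial>hausdorff_measure k)"
      using inc[of f A] by (simp add: image_comp SUP_mult_right_ennreal SUP_mult_left_ennreal[symmetric] nn_integral_monotone_convergence_SUP[symmetric])
    finally show ?case .
  qed
qed



section \<open>Boundaries of nested convex sets\<close>

text \<open>
  From a boundary point \<open>y\<close> of \<open>K\<close> follow the outer normal of a supporting hyperplane. Every
  point of this ray has \<open>y\<close> as its nearest point in \<open>K\<close>, and the ray has to cross the boundary
  of the larger bounded set.
\<close>

lemma frontier_subset_closest_point_image: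
  fixes K L :: "'a::euclidean_space set"
  assumes K: "convex K" "closed K" "interior K \<noteq> {}" and L: "bounded L"
    and t: "t > 0" and KL: "K \<subseteq> (\<lambda>x. c + t *\<^sub>R x) ` L"
  shows "frontier K \<subseteq> (\<lambda>x. closest_point K (c + t *\<^sub>R x)) ` frontier L"
proof
  fix y assume y: "y \<in> frontier K"
  then have yK: "y \<in> K" "y \<notin> rel_interior K"
    using K by (auto simp: frontier_def rel_interior_nonempty_interior)
  obtain a where a: "a \<noteq> 0" "\<And>x. x \<in> K \<Longrightarrow> a \<bullet> y \<le> a \<bullet> x"
    using supporting_hyperplane_rel_boundary[OF K(1) yK] by metis
  obtain p where p: "p \<in> L" "y = c + t *\<^sub>R p" using KL yK by auto
  define R where "R = (\<lambda>s. p - s *\<^sub>R a) ` {0..}"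
  have "connected R"
    unfolding R_def by (intro connected_continuous_image continuous_intros) (simp add: is_interval_connected is_interval_ci)
  moreover have "p \<in> R \<inter> L" using p by (auto simp: R_def intro!: image_eqI[of _ _ 0])
  moreover have "R - L \<noteq> {}"
  proof
    assume RL: "R - L = {}"
    obtain B where B: "B > 0" "\<And>x. x \<in> L \<Longrightarrow> norm x \<le> B" using L bounded_pos by blast
    define s where "s = (2 * B + 1) / norm a"
    have s: "s \<ge> 0" "norm (s *\<^sub>R a) = 2 * B + 1" using B a by (auto simp: s_def)
    then have "p - s *\<^sub>R a \<in> L" using RL by (auto simp: R_def)
    then have "norm (p - s *\<^sub>R a) \<le> B" "norm p \<le> B" using B p by auto
    moreover have "norm (s *\<^sub>R a) \<le> norm p + norm (p - s *\<^sub>R a)"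
      using norm_triangle_ineq4[of p "p - s *\<^sub>R a"] by simp
    ultimately show False using s B by linarith
  qed
  ultimately obtain q where "q \<in> R" "q \<in> frontier L" using connected_Int_frontier[of R L] by blast
  then obtain s where s: "s \<ge> 0" "q = p - s *\<^sub>R a" by (auto simp: R_def)
  have cq: "c + t *\<^sub>R q = y - (t * s) *\<^sub>R a" by (simp add: s p algebra_simps)
  have "dist (c + t *\<^sub>R q) y \<le> dist (c + t *\<^sub>R q) x" if x: "x \<in> K" for x
  proof -
    define v d where "v = (t * s) *\<^sub>R a" and "d = x - y"
    have "0 \<le> (t * s) * (a \<bullet> (x - y))" using a(2)[OF x] t s by (simp add: inner_diff_right)
    then have "0 \<le> v \<bullet> d" by (simp add: v_def d_def)
    moreover have "(v + d) \<bullet> (v + d) = v \<bullet> v + 2 * (v \<bullet> d) + d \<bullet> d"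
      by (simp add: inner_add_left inner_add_right inner_commute)
    ultimately have "v \<bullet> v \<le> (v + d) \<bullet> (v + d)"
      using inner_ge_zero[of d] by linarith
    then have "norm v \<le> norm (v + d)" by (simp add: norm_le)
    also have "norm (v + d) = norm (- (v + d))" by (rule norm_minus_cancel[symmetric])
    also have "- (v + d) = y - v - x" by (simp add: d_def)
    finally show ?thesis unfolding cq v_def[symmetric] by (simp add: dist_norm)
  qed
  then have "y = closest_point K (c + t *\<^sub>R q)"
    using K yK by (intro closest_point_unique) auto
  then show "y \<in> (\<lambda>x. closest_point K (c + t *\<^sub>R x)) ` frontier L"
    using \<open>q \<in> frontier L\<close> by auto
qed

lemma frontier_closure_convex:
  fixes E :: "'a::euclidean_space set"
  shows "convex E \<Longrightarrow> frontier (closure E) = frontier E"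
  by (simp add: frontier_def convex_interior_closure)

lemma frontier_subset_closest_point_image_closure:
  fixes E L :: "'a::euclidean_space set"
  assumes E: "convex E" "interior E \<noteq> {}" and L: "bounded L"
    and t: "t > 0" and EL: "E \<subseteq> (\<lambda>x. c + t *\<^sub>R x) ` L"
  shows "frontier E \<subseteq> (\<lambda>x. closest_point (closure E) (c + t *\<^sub>R x)) ` frontier L"
proof -
  have "compact ((\<lambda>x. c + t *\<^sub>R x) ` closure L)"
    using L by (intro compact_continuous_image continuous_intros) (simp add: compact_closure)
  then have "closed ((\<lambda>x. c + t *\<^sub>R x) ` closure L)"
    by (rule compact_imp_closed)
  moreover have "E \<subseteq> (\<lambda>x. c + t *\<^sub>R x) ` closure L"
    using EL closure_subset[of L] by blast
  ultimately have "closure E \<subseteq> (\<lambda>x. c + t *\<^sub>R x) ` closure L"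
    by (simp add: closure_minimal)
  then have "frontier (closure E) \<subseteq> (\<lambda>x. closest_point (closure E) (c + t *\<^sub>R x)) ` frontier (closure L)"
    using E L t by (intro frontier_subset_closest_point_image) (auto simp: convex_interior_closure)
  also have "\<dots> \<subseteq> (\<lambda>x. closest_point (closure E) (c + t *\<^sub>R x)) ` frontier L"
    using interior_mono[OF closure_subset[of L]] by (intro image_mono) (auto simp: frontier_def)
  finally show ?thesis using E by (simp add: frontier_closure_convex)
qed

text \<open>
  For \<open>g = 1\<close> this is the monotonicity of the perimeter of convex sets under inclusion,
  combined with its scaling.
\<close>

lemma nn_integral_frontier_le:
  fixes E L :: "'a::euclidean_space set"
  assumes E: "convex E" "interior E \<noteq> {}" and L: "bounded L"
    and t: "t > 0" and EL: "E \<subseteq> (\<lambda>x. c + t *\<^sub>R x) ` L"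
    and g: "g \<in> borel_measurable borel"
  shows "(\<integral>\<^sup>+y\<in>frontier E. g y \<partial>hausdorff_measure k)
    \<le> ennreal (t ^ k) * (\<integral>\<^sup>+x\<in>frontier L. g (closest_point (closure E) (c + t *\<^sub>R x)) \<partial>hausdorff_measure k)"
proof (rule nn_integral_hausdorff_Lipschitz_image)
  fix x y
  have "E \<noteq> {}" using E by auto
  then have "dist (closest_point (closure E) (c + t *\<^sub>R x)) (closest_point (closure E) (c + t *\<^sub>R y))
      \<le> dist (c + t *\<^sub>R x) (c + t *\<^sub>R y)"
    using E by (intro closest_point_lipschitz) auto
  then show "dist (closest_point (closure E) (c + t *\<^sub>R x)) (closest_point (closure E) (c + t *\<^sub>R y))
      \<le> t * dist x y"
    using t by (simp add: dist_norm flip: scaleR_diff_right)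
qed (use t g frontier_subset_closest_point_image_closure[OF E L t EL] in \<open>auto simp: borel_closed\<close>)

lemma perimeter_le:
  fixes E L :: "(real ^ 'n) set"
  assumes "convex E" "interior E \<noteq> {}" "bounded L" "t > 0" "E \<subseteq> (\<lambda>x. c + t *\<^sub>R x) ` L"
  shows "perimeter E \<le> ennreal (t ^ (CARD('n) - 1)) * perimeter L"
  using nn_integral_frontier_le[OF assms, of "\<lambda>_. 1" "CARD('n) - 1"]
  by (simp add: perimeter_def borel_closed)

lemma ennreal_inverse_antimono:
  fixes x y :: ennreal
  shows "x \<le> y \<Longrightarrow> inverse y \<le> inverse x"
  unfolding less_eq_ennreal.rep_eq inverse_ennreal.rep_eq by (rule ereal_inverse_antimono) simp_all

text \<open>
  The shape of every comparison of values of the functional: larger volume, smaller perimeter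
  and larger moment increase the value.
\<close>

lemma power_quotient_le:
  fixes v p w v' p' w' :: ennreal
  assumes v: "v \<le> ennreal \<alpha> * v'" and p: "p' \<le> ennreal \<beta> * p" and w: "w \<le> w'"
    and "\<alpha> > 0" "\<beta> > 0"
  shows "v ^ a / p ^ b * w \<le> ennreal (\<alpha> ^ a * \<beta> ^ b) * (v' ^ a / p' ^ b * w')"
proof -
  have "inverse (ennreal (\<beta> ^ b) * p ^ b) \<le> inverse (p' ^ b)"
    using power_mono[OF p, of b] \<open>\<beta> > 0\<close>
    by (intro ennreal_inverse_antimono) (auto simp: power_mult_distrib ennreal_power)
  moreover have "inverse (p ^ b) = ennreal (\<beta> ^ b) * inverse (ennreal (\<beta> ^ b) * p ^ b)"
    using \<open>\<beta> > 0\<close>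
    by (subst ennreal_inverse_mult') (auto simp: mult.assoc[symmetric] inverse_ennreal ennreal_mult[symmetric])
  ultimately have ip: "inverse (p ^ b) \<le> ennreal (\<beta> ^ b) * inverse (p' ^ b)"
    by (simp add: mult_left_mono)
  have iv: "v ^ a \<le> ennreal (\<alpha> ^ a) * v' ^ a"
    using power_mono[OF v, of a] \<open>\<alpha> > 0\<close> by (simp add: power_mult_distrib ennreal_power)
  have "v ^ a / p ^ b * w \<le> (ennreal (\<alpha> ^ a) * v' ^ a) * (ennreal (\<beta> ^ b) * inverse (p' ^ b)) * w'"
    unfolding divide_ennreal_def by (intro mult_mono iv ip w) auto
  also have "\<dots> = ennreal (\<alpha> ^ a * \<beta> ^ b) * (v' ^ a / p' ^ b * w')"
    using assms(4,5) by (simp add: ennreal_mult divide_ennreal_def mult_ac)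
  finally show ?thesis .
qed

section \<open>Similarity invariance\<close>

lemma frontier_affinity:
  fixes E :: "'a::euclidean_space set"
  assumes "t \<noteq> 0"
  shows "frontier ((\<lambda>x. c + t *\<^sub>R x) ` E) = (\<lambda>x. c + t *\<^sub>R x) ` frontier E"
proof -
  have "frontier ((*\<^sub>R) t ` E) = (*\<^sub>R) t ` frontier E"
    using assms interior_injective_linear_image[of "(*\<^sub>R) t" E]
    by (simp add: frontier_def closure_scaleR image_set_diff inj_def)
  moreover have "(\<lambda>x. c + t *\<^sub>R x) ` X = (+) c ` ((*\<^sub>R) t ` X)" for X by (simp add: image_image)
  ultimately show ?thesis by (simp add: frontier_translation)
qed

lemma emeasure_lborel_affinity:
  fixes E :: "'a::euclidean_space set"
  assumes "E \<in> sets borel" "(\<lambda>x. c + t *\<^sub>R x) ` E \<in> sets borel"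
  shows "emeasure lborel ((\<lambda>x. c + t *\<^sub>R x) ` E) = ennreal (\<bar>t\<bar> ^ DIM('a)) * emeasure lborel E"
  using emeasure_lebesgue_affine[of t c E] assms by (simp add: add.commute ennreal_power)

text \<open>
  The map \<open>x\<^sub>0 \<mapsto> moment E x\<^sub>0\<close> is kept apart from its infimum, since all estimates below hold for
  each centre \<open>x\<^sub>0\<close> separately.
\<close>

definition moment :: "(real ^ 'n) set \<Rightarrow> real ^ 'n \<Rightarrow> ennreal" where
  "moment E x\<^sub>0 = (\<integral>\<^sup>+x\<in>frontier E. ennreal ((norm (x - x\<^sub>0))\<^sup>2) \<partial>hausdorff_measure (CARD('n) - 1))"

lemma shape_functional_moment:
  "shape_functional (E :: (real ^ 'n) set) = emeasure lborel E ^ ((CARD('n) - 2) * (CARD('n) + 1))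
     / perimeter E ^ (CARD('n)\<^sup>2 - 1) * (INF x\<^sub>0. moment E x\<^sub>0)"
  by (simp add: shape_functional_def moment_def)

text \<open>
  The powers of length in the volume, perimeter and moment factors of the functional cancel.
\<close>

lemma exponent_scaling:
  assumes "n \<ge> (2::nat)"
  shows "n * ((n - 2) * (n + 1)) + (n + 1) = (n - 1) * (n\<^sup>2 - 1)"
proof -
  obtain m where "n = m + 2" using assms by (metis add.commute le_Suc_ex)
  then show ?thesis by (simp add: power2_eq_square algebra_simps)
qed

text \<open>
  By the cancellation of exponents the two values are in fact equal; the inequality suffices for
  passing to a normalized body.
\<close>

lemma shape_functional_affinity_le:
  fixes E :: "(real ^ 'n) set"
  assumes n: "CARD('n) \<ge> 2" and E: "open E" and t: "t > 0"
  shows "shape_functional E \<le> shape_functional ((\<lambda>x. c + t *\<^sub>R x) ` E)"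
proof -
  let ?n = "CARD('n)"
  define E' where "E' = (\<lambda>x. c + t *\<^sub>R x) ` E"
  have fr: "frontier E' = (\<lambda>x. c + t *\<^sub>R x) ` frontier E"
    using t by (simp add: E'_def frontier_affinity)
  have [measurable]: "frontier E' \<in> sets borel" by (simp add: borel_closed)
  have "open E'"
    using open_affinity[OF E, of t c] t by (simp add: E'_def)
  have "emeasure lborel E' = ennreal (t ^ ?n) * emeasure lborel E"
    using emeasure_lborel_affinity[of E c t] E \<open>open E'\<close> t by (simp add: E'_def)
  then have v: "emeasure lborel E \<le> ennreal ((1 / t) ^ ?n) * emeasure lborel E'"
    using t by (simp add: mult.assoc[symmetric] ennreal_mult[symmetric] power_divide)
  have p: "perimeter E' \<le> ennreal (t ^ (?n - 1)) * perimeter E"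
    using hausdorff_outer_Lipschitz_image[of t "frontier E" "\<lambda>x. c + t *\<^sub>R x" "?n - 1"] t
    by (simp add: perimeter_def fr[symmetric] emeasure_hausdorff_measure borel_closed dist_norm flip: scaleR_diff_right)
  have w: "(INF x. moment E x) \<le> ennreal ((1 / t) ^ (?n + 1)) * (INF x. moment E' x)"
  proof -
    have "(INF x. moment E x) / ennreal ((1 / t) ^ (?n + 1)) \<le> moment E' x" for x
    proof -
      let ?f = "\<lambda>y. (1 / t) *\<^sub>R (y - c)"
      have "(INF x. moment E x) \<le> moment E (?f x)"
        by (rule INF_lower) simp
      also have "\<dots> \<le> ennreal ((1 / t) ^ (?n - 1)) * (\<integral>\<^sup>+y\<in>frontier E'. ennreal ((norm (?f y - ?f x))\<^sup>2) \<partial>hausdorff_measure (?n - 1))"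
        unfolding moment_def
      proof (rule nn_integral_hausdorff_Lipschitz_image)
        show "frontier E \<subseteq> ?f ` frontier E'"
          using t by (auto simp: fr image_image)
        show "dist (?f x) (?f y) \<le> 1 / t * dist x y" for x y
          using t by (simp add: dist_norm flip: scaleR_diff_right)
      qed (use t in \<open>auto simp: borel_closed\<close>)
      also have "(\<integral>\<^sup>+y\<in>frontier E'. ennreal ((norm (?f y - ?f x))\<^sup>2) \<partial>hausdorff_measure (?n - 1))
          = (\<integral>\<^sup>+y. ennreal ((1 / t)\<^sup>2) * (ennreal ((norm (y - x))\<^sup>2) * indicator (frontier E') y) \<partial>hausdorff_measure (?n - 1))"
        using t by (intro nn_integral_cong) (simp add: ennreal_mult[symmetric] mult.assoc[symmetric] power_divide flip: scaleR_diff_right)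
      also have "\<dots> = ennreal ((1 / t)\<^sup>2) * moment E' x"
        unfolding moment_def by (intro nn_integral_cmult) simp
      finally have "(INF x. moment E x) \<le> ennreal ((1 / t) ^ (?n - 1)) * (ennreal ((1 / t)\<^sup>2) * moment E' x)" .
      also have "\<dots> = ennreal ((1 / t) ^ (?n - 1 + 2)) * moment E' x"
        using t by (simp only: power_add ennreal_mult mult.assoc) (simp add: ennreal_mult mult.assoc)
      also have "?n - 1 + 2 = ?n + 1" using n by simp
      finally show ?thesis
        using t by (intro divide_le_posI_ennreal) auto
    qed
    then have "(INF x. moment E x) / ennreal ((1 / t) ^ (?n + 1)) \<le> (INF x. moment E' x)"
      by (rule INF_greatest)
    then show ?thesis using t by (intro ennreal_le_mult_if_divide_le) auto
  qed
  let ?a = "(?n - 2) * (?n + 1)" and ?b = "?n\<^sup>2 - 1"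
  have "((1 / t) ^ ?n) ^ ?a * (t ^ (?n - 1)) ^ ?b * (1 / t) ^ (?n + 1)
      = (1 / t) ^ (?n * ?a + (?n + 1)) * t ^ ((?n - 1) * ?b)"
    by (simp only: power_add power_mult mult_ac)
  also have "\<dots> = 1"
    unfolding exponent_scaling[OF n] using t by (simp add: power_divide)
  finally have one: "((1 / t) ^ ?n) ^ ?a * (t ^ (?n - 1)) ^ ?b * (1 / t) ^ (?n + 1) = 1" .
  have "shape_functional E \<le> ennreal (((1 / t) ^ ?n) ^ ?a * (t ^ (?n - 1)) ^ ?b) *
      (emeasure lborel E' ^ ?a / perimeter E' ^ ?b * (ennreal ((1 / t) ^ (?n + 1)) * (INF x. moment E' x)))"
    unfolding shape_functional_moment by (intro power_quotient_le v p w) (use t in auto)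
  also have "\<dots> = ennreal (((1 / t) ^ ?n) ^ ?a * (t ^ (?n - 1)) ^ ?b * (1 / t) ^ (?n + 1)) * shape_functional E'"
    using t ennreal_mult[of "((1 / t) ^ ?n) ^ ?a * (t ^ (?n - 1)) ^ ?b" "(1 / t) ^ (?n + 1)"]
    by (simp only: shape_functional_moment E'_def[symmetric] mult_ac) (simp add: mult_ac)
  also have "\<dots> = shape_functional E'" by (simp only: one) simp
  finally show ?thesis unfolding E'_def .
qed



section \<open>Volume, perimeter and width\<close>

lemma emeasure_lborel_long_box:
  fixes c :: "real ^ 'n"
  assumes "h \<ge> 0" "d \<ge> 0"
  shows "emeasure lborel (cbox (c - (\<chi> j. if j = i then h else d)) (c + (\<chi> j. if j = i then h else d)))
     = ennreal (2 * h * (2 * d) ^ (CARD('n) - 1))"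
proof -
  let ?r = "\<chi> j. if j = i then h else d"
  have "cbox (c - ?r) (c + ?r) \<noteq> {}"
    using assms by (simp add: interval_ne_empty_cart)
  then have "measure lborel (cbox (c - ?r) (c + ?r)) = (\<Prod>j\<in>UNIV. (c + ?r) $ j - (c - ?r) $ j)"
    by (rule content_cbox_cart)
  also have "\<dots> = (\<Prod>j\<in>UNIV. 2 * (if j = i then h else d))"
    by (intro prod.cong) auto
  also have "\<dots> = 2 * h * (\<Prod>j\<in>UNIV - {i}. 2 * (if j = i then h else d))"
    by (subst prod.remove[of _ i]) auto
  also have "(\<Prod>j\<in>UNIV - {i}. 2 * (if j = i then h else d)) = (\<Prod>j\<in>UNIV - {i}. 2 * d)"
    by (intro prod.cong) auto
  also have "\<dots> = (2 * d) ^ (CARD('n) - 1)"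
    by (simp add: card_Diff_singleton)
  finally have "measure lborel (cbox (c - ?r) (c + ?r)) = 2 * h * (2 * d) ^ (CARD('n) - 1)" .
  then show ?thesis
    by (subst emeasure_eq_ennreal_measure) (use emeasure_lborel_cbox_finite[of "c - ?r" "c + ?r"] in \<open>auto simp: less_top\<close>)
qed

text \<open>
  A cover of \<open>F\<close> by sets of diameter \<open>d \<le> h\<close>, thickened by \<open>h\<close> in the coordinate direction \<open>i\<close>,
  covers \<open>E\<close>. Each thickened set lies in a box with one side \<open>4h\<close> and all others \<open>2d\<close>, whose
  volume is a multiple of \<open>h\<close> times the Hausdorff weight. Thickening along a coordinate axis keeps
  the boxes parallel to the axes.
\<close>

lemma emeasure_le_chord_times_frontier:
  fixes E :: "(real ^ 'n) set"
  assumes h: "h > 0"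
    and chord: "\<And>x. x \<in> E \<Longrightarrow> \<exists>t. \<bar>t\<bar> \<le> h \<and> x + t *\<^sub>R axis i 1 \<in> F"
  shows "emeasure lborel E
    \<le> ennreal (4 ^ CARD('n) / unit_ball_vol (real (CARD('n) - 1)) * h) * hausdorff_outer (CARD('n) - 1) F"
proof -
  define k where "k = CARD('n) - 1"
  define \<omega> where "\<omega> = unit_ball_vol (real k)"
  define M where "M = 4 ^ CARD('n) / \<omega> * h"
  have \<omega>: "\<omega> > 0" by (simp add: \<omega>_def)
  have M: "M > 0" using \<omega> h by (simp add: M_def)
  have card: "CARD('n) = Suc k" by (simp add: k_def)
  have "emeasure lborel E / ennreal M \<le> hausdorff_pre k h F"
    unfolding hausdorff_pre_def
  proof (rule INF_greatest, clarify)
    fix C :: "nat \<Rightarrow> (real ^ 'n) set"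
    assume cov: "F \<subseteq> (\<Union>j. C j)" and C: "\<forall>j. bounded (C j) \<and> diameter (C j) \<le> h"
    (* the half-side 2 h in direction i covers the shift by at most h and the diameter, which is at most h *)
    define r where "r j = (\<chi> l. if l = i then 2 * h else diameter (C j))" for j
    define c where "c j = (SOME y. y \<in> C j)" for j
    define B where "B j = (if C j = {} then {} else cbox (c j - r j) (c j + r j))" for j
    have d0: "diameter (C j) \<ge> 0" for j using C diameter_ge_0 by blast
    have cC: "c j \<in> C j" if "C j \<noteq> {}" for j using that unfolding c_def by (simp add: some_in_eq)
    have "E \<subseteq> (\<Union>j. B j)"
    proof
      fix x assume "x \<in> E"
      then obtain t where t: "\<bar>t\<bar> \<le> h" "x + t *\<^sub>R axis i 1 \<in> F" using chord by blast
      then obtain j where j: "x + t *\<^sub>R axis i 1 \<in> C j" using cov by blast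
      then have ne: "C j \<noteq> {}" by auto
      have near: "\<bar>x $ l + t * axis i 1 $ l - c j $ l\<bar> \<le> diameter (C j)" for l
      proof -
        have "\<bar>(x + t *\<^sub>R axis i 1 - c j) $ l\<bar> \<le> norm (x + t *\<^sub>R axis i 1 - c j)"
          by (rule component_le_norm_cart)
        also have "\<dots> \<le> diameter (C j)"
          using diameter_bounded_bound[of "C j"] C j cC[OF ne] by (auto simp: dist_norm)
        finally show ?thesis by simp
      qed
      have "\<bar>x $ l - c j $ l\<bar> \<le> r j $ l" for l
        using near[of l] t(1) C[rule_format, of j] by (auto simp: r_def axis_def split: if_splits)
      then have "x \<in> B j" using ne by (auto simp: B_def mem_box_cart abs_le_iff algebra_simps)
      then show "x \<in> (\<Union>j. B j)" by blast
    qed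
    then have "emeasure lborel E \<le> emeasure lborel (\<Union>j. B j)"
      by (intro emeasure_mono) (auto simp: B_def)
    also have "\<dots> \<le> (\<Sum>j. emeasure lborel (B j))"
      by (intro emeasure_subadditive_countably) (auto simp: B_def)
    also have "\<dots> \<le> (\<Sum>j. ennreal M * hausdorff_weight k (C j))"
    proof (intro suminf_le)
      fix j
      have "2 * (2 * h) * (2 * diameter (C j)) ^ k = M * (\<omega> * (diameter (C j) / 2) ^ k)"
      proof -
        have "(2 * diameter (C j)) ^ k = (4 * (diameter (C j) / 2)) ^ k" by simp
        also have "\<dots> = 4 ^ k * (diameter (C j) / 2) ^ k" by (rule power_mult_distrib)
        finally have "(2 * diameter (C j)) ^ k = 4 ^ k * (diameter (C j) / 2) ^ k" .
        then show ?thesis using \<omega> by (simp add: M_def card)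
      qed
      moreover have "emeasure lborel (cbox (c j - r j) (c j + r j)) = ennreal (2 * (2 * h) * (2 * diameter (C j)) ^ k)"
        unfolding r_def k_def by (rule emeasure_lborel_long_box) (use h d0 in auto)
      ultimately show "emeasure lborel (B j) \<le> ennreal M * hausdorff_weight k (C j)"
        using M \<omega> d0[of j]
        by (simp only: B_def hausdorff_weight_def \<omega>_def[symmetric]) (simp add: ennreal_mult[symmetric])
    qed auto
    also have "\<dots> = ennreal M * (\<Sum>j. hausdorff_weight k (C j))"
      by (rule ennreal_suminf_cmult)
    finally show "emeasure lborel E / ennreal M \<le> (\<Sum>j. hausdorff_weight k (C j))"
      using M by (intro divide_le_posI_ennreal) auto
  qed
  also have "\<dots> \<le> hausdorff_outer k F"
    unfolding hausdorff_outer_def using h by (intro SUP_upper) auto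
  finally have "emeasure lborel E \<le> ennreal M * hausdorff_outer k F"
    using M by (intro ennreal_le_mult_if_divide_le)
  then show ?thesis by (simp add: M_def \<omega>_def k_def)
qed

text \<open>
  The unit vector \<open>u\<close> has a coordinate of absolute value at least \<open>1/n\<close>. Chords of \<open>E\<close> parallel
  to the corresponding axis have length at most \<open>n W\<close>.
\<close>

lemma emeasure_le_width_times_perimeter:
  fixes E :: "(real ^ 'n) set" and W :: real
  assumes E: "open E" "bounded E" and W: "W > 0" and u: "norm u = 1"
    and width: "\<And>x y. x \<in> closure E \<Longrightarrow> y \<in> closure E \<Longrightarrow> u \<bullet> (x - y) \<le> W"
  shows "emeasure lborel E
    \<le> ennreal (4 ^ CARD('n) / unit_ball_vol (real (CARD('n) - 1)) * (CARD('n) * W)) * perimeter E"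
proof -
  have "\<exists>i. \<bar>u $ i\<bar> \<ge> 1 / CARD('n)"
  proof (rule ccontr)
    assume "\<not> ?thesis"
    then have "(\<Sum>i\<in>UNIV. \<bar>u $ i\<bar>) < (\<Sum>i\<in>(UNIV::'n set). 1 / CARD('n))"
      by (intro sum_strict_mono) (auto simp: not_le)
    then show False using norm_le_l1_cart[of u] u by simp
  qed
  then obtain i where i: "\<bar>u $ i\<bar> \<ge> 1 / CARD('n)" by blast
  have "\<exists>t. \<bar>t\<bar> \<le> real CARD('n) * W \<and> x + t *\<^sub>R axis i 1 \<in> frontier E" if x: "x \<in> E" for x
  proof -
    have "x \<in> interior E" using x E by (simp add: interior_open)
    then obtain t where t: "t > 0" "x + t *\<^sub>R axis i 1 \<in> frontier E"
      using ray_to_frontier[OF E(2), of x "axis i 1"] by (metis axis_eq_0_iff zero_neq_one)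
    let ?y = "x + t *\<^sub>R axis i 1"
    have cl: "x \<in> closure E" "?y \<in> closure E"
      using x t closure_subset by (auto simp: frontier_def)
    have "t * (u $ i) \<le> W" "- (t * (u $ i)) \<le> W"
      using width[OF cl(2) cl(1)] width[OF cl] by (simp_all add: inner_axis)
    then have "t * \<bar>u $ i\<bar> \<le> W" by (simp add: abs_if)
    moreover have "t * (1 / CARD('n)) \<le> t * \<bar>u $ i\<bar>"
      using i t by (intro mult_left_mono) auto
    ultimately have "t / CARD('n) \<le> W" by simp
    then have "t \<le> CARD('n) * W" by (simp add: field_simps)
    then show ?thesis using t by (intro exI[of _ t]) auto
  qed
  then show ?thesis
    using emeasure_le_chord_times_frontier[of "CARD('n) * W" E i "frontier E"] W E
    by (simp add: perimeter_def emeasure_hausdorff_measure borel_closed)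
qed

section \<open>Inscribed balls\<close>

text \<open>
  Minkowski's measure of asymmetry: every chord through \<open>z\<close> is divided by \<open>z\<close> in a ratio of at
  most \<open>n : 1\<close>. For \<open>x\<close> in \<open>S\<close> let \<open>A x\<close> consist of the points \<open>(x + n y)/(n + 1)\<close> with \<open>y\<close> in \<open>S\<close>. Any
  \<open>n + 1\<close> of these convex sets share the centroid of the corresponding points \<open>x\<close>, so by Helly's
  theorem and compactness they all share a point.
\<close>

lemma asymmetry_bounded_by_dimension:
  fixes S :: "'a::euclidean_space set"
  assumes S: "compact S" "convex S" "S \<noteq> {}"
  obtains z where "\<And>x. x \<in> S \<Longrightarrow> \<exists>y\<in>S. real (DIM('a) + 1) *\<^sub>R z = x + real DIM('a) *\<^sub>R y"
proof -
  let ?n = "DIM('a)"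
  define A where "A x = (\<lambda>y. (1 / real (?n + 1)) *\<^sub>R x + (real ?n / real (?n + 1)) *\<^sub>R y) ` S" for x
  have convA: "convex (A x)" for x
    unfolding A_def using S by (intro convex_affinity)
  have "compact (A x)" for x
    unfolding A_def using S by (intro compact_continuous_image continuous_intros)
  then have closA: "closed (A x)" for x by (rule compact_imp_closed)
  have AS: "A x \<subseteq> S" if "x \<in> S" for x
  proof -
    have "(1 / real (?n + 1)) *\<^sub>R x + (real ?n / real (?n + 1)) *\<^sub>R y \<in> S" if "y \<in> S" for y
      using S \<open>x \<in> S\<close> that by (intro convexD) (auto simp: field_simps)
    then show ?thesis by (auto simp: A_def)
  qed
  have few: "(\<Inter>x\<in>J. A x) \<noteq> {}" if J: "J \<subseteq> S" "finite J" "card J \<le> ?n + 1" "J \<noteq> {}" for J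
  proof -
    obtain p where p: "p \<in> J" using J by blast
    (* with fewer than n + 1 points, p is repeated to make up the number in the centroid *)
    define e where "e = real (?n + 1) - real (card J)"
    define z where "z = (1 / real (?n + 1)) *\<^sub>R (\<Sum>J + e *\<^sub>R p)"
    have "z \<in> A x" if x: "x \<in> J" for x
    proof -
      define a where "a j = (if j = x then 0 else 1 / real ?n) + (if j = p then e / real ?n else 0)" for j
      have a: "a j = 1 / real ?n + (if j = p then e / real ?n else 0) - (if j = x then 1 / real ?n else 0)" for j
        by (simp add: a_def)
      define y where "y = (\<Sum>j\<in>J. a j *\<^sub>R j)"
      have "y \<in> S"
        unfolding y_def
      proof (rule convex_sum)
        show "sum a J = 1"
          using J x p by (simp add: a sum.distrib sum_subtractf e_def add_divide_distrib[symmetric] diff_divide_distrib[symmetric])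
        show "a j \<ge> 0" for j using J by (auto simp: a_def e_def)
      qed (use J S in auto)
      moreover have "y = (1 / real ?n) *\<^sub>R (\<Sum>J + e *\<^sub>R p - x)"
      proof -
        have "y = (\<Sum>j\<in>J. (1 / real ?n) *\<^sub>R j + (if j = p then (e / real ?n) *\<^sub>R p else 0) - (if j = x then (1 / real ?n) *\<^sub>R x else 0))"
          unfolding y_def by (intro sum.cong) (auto simp: a algebra_simps)
        also have "\<dots> = (1 / real ?n) *\<^sub>R (\<Sum>J + e *\<^sub>R p - x)"
          using J x p by (simp add: sum.distrib sum_subtractf scaleR_sum_right algebra_simps)
        finally show ?thesis .
      qed
      then have ny: "real ?n *\<^sub>R y = \<Sum>J + e *\<^sub>R p - x" by simp
      have "z = (1 / real (?n + 1)) *\<^sub>R (x + real ?n *\<^sub>R y)"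
        unfolding ny z_def by simp
      then have "z = (1 / real (?n + 1)) *\<^sub>R x + (real ?n / real (?n + 1)) *\<^sub>R y"
        by (simp add: scaleR_add_right)
      ultimately show ?thesis unfolding A_def by blast
    qed
    then show ?thesis by blast
  qed
  have "S \<inter> (\<Inter>x\<in>S. A x) \<noteq> {}"
  proof (rule compact_imp_fip_image[OF S(1) closA])
    fix I assume I: "finite I" "I \<subseteq> S"
    (* Helly concerns sets of sets, so points x with the same A x are first identified *)
    have "(\<Inter>x\<in>I. A x) \<noteq> {}" if "I \<noteq> {}"
    proof (cases "card (A ` I) \<ge> ?n + 1")
      case True
      show ?thesis
      proof (rule Helly[OF True])
        fix t assume t: "t \<subseteq> A ` I" "card t = ?n + 1"
        then obtain J where J: "J \<subseteq> I" "inj_on A J" "t = A ` J"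
          by (meson subset_image_inj)
        then have "card J = ?n + 1" using t by (simp add: card_image)
        moreover have "J \<noteq> {}" using \<open>card J = ?n + 1\<close> by auto
        ultimately show "\<Inter>t \<noteq> {}"
          using few[of J] J I by (auto intro: finite_subset)
      qed (use convA in auto)
    next
      case False
      obtain J where J: "J \<subseteq> I" "inj_on A J" "A ` I = A ` J"
        by (meson subset_image_inj order_refl)
      then have "card J = card (A ` I)" by (simp add: card_image)
      moreover have "J \<noteq> {}" using J that by auto
      moreover have "finite J" "J \<subseteq> S" using J I by (auto intro: finite_subset)
      ultimately show ?thesis
        using few[of J] J(3) False by simp
    qed
    then show "S \<inter> (\<Inter>x\<in>I. A x) \<noteq> {}"
      using I(2) AS S(3) by (cases "I = {}") blast+
  qed
  then obtain z where z: "\<And>x. x \<in> S \<Longrightarrow> z \<in> A x" by blast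
  show ?thesis
  proof
    fix x assume "x \<in> S"
    then obtain y where "y \<in> S" "z = (1 / real (?n + 1)) *\<^sub>R x + (real ?n / real (?n + 1)) *\<^sub>R y"
      using z unfolding A_def by blast
    then show "\<exists>y\<in>S. real (?n + 1) *\<^sub>R z = x + real ?n *\<^sub>R y"
      by (intro bexI[of _ y]) (simp_all add: scaleR_add_right del: of_nat_add of_nat_Suc)
  qed
qed

text \<open>
  A weak form of Steinhagen's theorem. If the ball of radius \<open>r\<close> around the centre \<open>z\<close> of bounded
  asymmetry leaves \<open>S\<close>, then some half-space containing \<open>S\<close> has its boundary within distance
  \<open>r\<close> of \<open>z\<close>, and by the asymmetry bound \<open>S\<close> extends at most \<open>n r\<close> beyond \<open>z\<close> in the other direction.
\<close>

lemma inscribed_ball_or_thin: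
  fixes S :: "'a::euclidean_space set"
  assumes S: "compact S" "convex S" "S \<noteq> {}"
  obtains z where "cball z r \<subseteq> S"
  | u where "norm u = 1" "\<And>x y. x \<in> S \<Longrightarrow> y \<in> S \<Longrightarrow> u \<bullet> (x - y) \<le> real (DIM('a) + 1) * r"
proof -
  let ?n = "real DIM('a)"
  obtain z where z: "\<And>x. x \<in> S \<Longrightarrow> \<exists>y\<in>S. real (DIM('a) + 1) *\<^sub>R z = x + ?n *\<^sub>R y"
    using asymmetry_bounded_by_dimension[OF S] by blast
  show ?thesis
  proof (cases "cball z r \<subseteq> S")
    case True
    then show ?thesis by (rule that(1))
  next
    case False
    then obtain q where q: "dist z q \<le> r" "q \<notin> S" by (metis mem_cball subsetI)
    obtain a b where ab: "a \<bullet> q < b" "\<And>x. x \<in> S \<Longrightarrow> a \<bullet> x \<ge> b"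
      using supporting_hyperplane_closed_point[OF S(2) compact_imp_closed[OF S(1)] S(3) q(2)] by blast
    have a0: "a \<noteq> 0" using ab S by fastforce
    have "a \<bullet> (z - q) \<le> norm a * r"
      using norm_cauchy_schwarz[of a "z - q"] mult_left_mono[OF q(1) norm_ge_zero[of a]] by (simp add: dist_norm)
    then have low: "a \<bullet> z - a \<bullet> x \<le> norm a * r" if "x \<in> S" for x
      using ab(1) ab(2)[OF that] by (simp add: inner_diff_right)
    have up: "a \<bullet> x - a \<bullet> z \<le> ?n * (norm a * r)" if x: "x \<in> S" for x
    proof -
      obtain y where y: "y \<in> S" "real (DIM('a) + 1) *\<^sub>R z = x + ?n *\<^sub>R y" using z[OF x] by blast
      have "a \<bullet> (real (DIM('a) + 1) *\<^sub>R z) = a \<bullet> (x + ?n *\<^sub>R y)" by (simp only: y)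
      then have "a \<bullet> x - a \<bullet> z = ?n * (a \<bullet> z - a \<bullet> y)"
        by (simp add: inner_add_right algebra_simps)
      then show ?thesis using low[OF y(1)] by (simp add: mult_left_mono)
    qed
    show ?thesis
    proof (rule that(2))
      show "norm (a /\<^sub>R norm a) = 1" using a0 by simp
      fix x y assume "x \<in> S" "y \<in> S"
      then have "a \<bullet> (x - y) \<le> norm a * (real (DIM('a) + 1) * r)"
        using up[of x] low[of y] by (simp add: inner_diff_right algebra_simps)
      then show "(a /\<^sub>R norm a) \<bullet> (x - y) \<le> real (DIM('a) + 1) * r"
        using a0 by (simp add: field_simps)
    qed
  qed
qed

text \<open>
  The convex hull of the ball and \<open>q\<close> contains a ball of radius \<open>r / 2\<close> around each point of the
  first half of the segment from \<open>z\<close> to \<open>q\<close>. Along this half at least \<open>1 / (8 r)\<close> such balls are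
  disjoint, so the volume is of order \<open>r^(n-1)\<close>, not merely \<open>r^n\<close>.
\<close>

lemma emeasure_ge_ball_and_point:
  fixes E :: "'a::euclidean_space set"
  assumes E: "convex E" "E \<in> sets borel" and r: "r > 0" "cball z r \<subseteq> E"
    and q: "q \<in> E" "dist z q \<ge> 1 / 4"
  shows "ennreal (unit_ball_vol (real DIM('a)) * (r / 2) ^ DIM('a) / (8 * r)) \<le> emeasure lborel E"
proof -
  define N where "N = Suc (nat \<lfloor>1 / (8 * r)\<rfloor>)"
  (* steps of relative length 4 r have length at least r, as q has distance at least 1/4 from z *)
  define x where "x j = z + (4 * r * real j) *\<^sub>R (q - z)" for j :: nat
  define \<kappa> where "\<kappa> = unit_ball_vol (real DIM('a)) * (r / 2) ^ DIM('a)"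
  have \<kappa>: "\<kappa> \<ge> 0" using r by (simp add: \<kappa>_def)
  have N: "1 / (8 * r) \<le> real N" unfolding N_def by linarith
  have small: "4 * r * real j \<le> 1 / 2" if "j < N" for j
  proof -
    have "real j \<le> 1 / (8 * r)" using that r unfolding N_def
      by (simp add: less_Suc_eq_le le_nat_floor le_nat_iff le_floor_iff)
    then show ?thesis using r by (simp add: field_simps)
  qed
  have sub: "ball (x j) (r / 2) \<subseteq> E" if "j < N" for j
  proof
    fix w assume w: "w \<in> ball (x j) (r / 2)"
    define s where "s = 4 * r * real j"
    have s: "0 \<le> s" "s \<le> 1 / 2" using small[OF that] r by (auto simp: s_def)
    define v where "v = (1 / (1 - s)) *\<^sub>R (w - x j)"
    have "norm (w - x j) \<le> r / 2" using w by (simp add: dist_norm norm_minus_commute)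
    also have "\<dots> \<le> r * (1 - s)" using s r mult_left_mono[of "1/2" "1 - s" r] by simp
    finally have "norm (w - x j) / (1 - s) \<le> r" using s by (simp add: pos_divide_le_eq)
    then have "norm v \<le> r" using s by (simp add: v_def)
    then have "z + v \<in> E" using r by (auto simp: dist_norm)
    then have "(1 - s) *\<^sub>R (z + v) + s *\<^sub>R q \<in> E"
      using E(1) q s by (intro convexD) auto
    also have "(1 - s) *\<^sub>R (z + v) + s *\<^sub>R q = (1 - s) *\<^sub>R v + (z + s *\<^sub>R (q - z))"
      by (simp add: algebra_simps)
    also have "(1 - s) *\<^sub>R v = w - x j" using s by (simp add: v_def)
    also have "z + s *\<^sub>R (q - z) = x j" by (simp add: x_def s_def)
    finally show "w \<in> E" by simp
  qed
  have "disjoint_family_on (\<lambda>j. ball (x j) (r / 2)) {..<N}"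
    unfolding disjoint_family_on_def
  proof (intro ballI impI)
    fix i j :: nat assume "i \<noteq> j"
    then have "1 \<le> \<bar>real i - real j\<bar>" by linarith
    have "x i - x j = (4 * r * (real i - real j)) *\<^sub>R (q - z)" by (simp add: x_def algebra_simps)
    then have "dist (x i) (x j) = 4 * r * \<bar>real i - real j\<bar> * dist z q"
      using r by (simp add: dist_norm norm_minus_commute abs_mult)
    also have "\<dots> \<ge> 4 * r * 1 * (1 / 4)"
      using r q \<open>1 \<le> \<bar>real i - real j\<bar>\<close> by (intro mult_mono) auto
    finally have "r \<le> dist (x i) (x j)" by simp
    then show "ball (x i) (r / 2) \<inter> ball (x j) (r / 2) = {}"
      by (intro disjoint_ballI) simp
  qed
  then have "emeasure lborel (\<Union>j<N. ball (x j) (r / 2)) = (\<Sum>j<N. emeasure lborel (ball (x j) (r / 2)))"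
    by (intro sum_emeasure[symmetric]) auto
  also have "\<dots> = ennreal (real N * \<kappa>)"
    using r \<kappa> by (simp add: emeasure_ball \<kappa>_def[symmetric] ennreal_mult ennreal_of_nat_eq_real_of_nat)
  finally have "ennreal (real N * \<kappa>) \<le> emeasure lborel E"
    using sub E(2) by (metis (mono_tags, lifting) UN_least emeasure_mono lessThan_iff sets_lborel)
  moreover have "\<kappa> / (8 * r) \<le> real N * \<kappa>"
    using mult_right_mono[OF N \<kappa>] by simp
  ultimately show ?thesis
    unfolding \<kappa>_def[symmetric] using ennreal_leI order_trans by blast
qed



section \<open>A lower bound on the functional prevents collapse\<close>

text \<open>
  Here \<open>v\<close>, \<open>p\<close>, \<open>\<rho>\<close> are volume, perimeter and inradius, and \<open>S\<close> is a lower bound for the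
  functional. Eliminating \<open>p\<close> and \<open>v\<close> works out because \<open>b - 1 = a + n = n (n - 1) + (n - 2)\<close>: what
  remains is \<open>\<rho>^(n-2)\<close>, which is at most \<open>\<rho>\<close>.
\<close>

lemma inradius_ge_arith:
  fixes n :: nat and v p \<rho> S C c :: real
  defines "a \<equiv> (n - 2) * (n + 1)" and "b \<equiv> n\<^sup>2 - 1"
  assumes n: "n \<ge> 3" and pos: "v > 0" "p > 0" "\<rho> > 0" "\<rho> \<le> 1" "C > 0" "c > 0" "S \<ge> 0"
    and v1: "v \<le> C * \<rho> * p" and v2: "c * \<rho> ^ (n - 1) \<le> v" and S: "S \<le> v ^ a / p ^ b * p"
  shows "S * c ^ n \<le> C ^ (a + n) * \<rho>"
proof -
  obtain m where m: "n = m + 2" "m \<ge> 1"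
  proof -
    obtain l where "n = 3 + l" using le_Suc_ex[OF n] by blast
    then show ?thesis by (intro that[of "l + 1"]) auto
  qed
  have b: "b = Suc (a + n)" and an: "a + n = n * (n - 1) + m"
    by (simp_all add: a_def b_def m power2_eq_square algebra_simps)
  have Sp: "S * p ^ (a + n) \<le> v ^ a"
    using S pos by (simp add: b field_simps)
  have "v ^ a * (S * v ^ n) = S * v ^ (a + n)" by (simp add: power_add)
  also have "\<dots> \<le> S * (C * \<rho> * p) ^ (a + n)"
    using v1 pos by (intro mult_left_mono power_mono) auto
  also have "\<dots> = (S * p ^ (a + n)) * (C * \<rho>) ^ (a + n)" by (simp only: power_mult_distrib mult_ac)
  also have "\<dots> \<le> v ^ a * (C * \<rho>) ^ (a + n)"
    using pos by (intro mult_right_mono Sp) auto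
  finally have "S * v ^ n \<le> (C * \<rho>) ^ (a + n)" using pos by simp
  moreover have "S * (c * \<rho> ^ (n - 1)) ^ n \<le> S * v ^ n"
    using v2 pos by (intro mult_left_mono power_mono) auto
  ultimately have "S * (c * \<rho> ^ (n - 1)) ^ n \<le> (C * \<rho>) ^ (a + n)" by linarith
  moreover have "S * (c * \<rho> ^ (n - 1)) ^ n = \<rho> ^ (n * (n - 1)) * (S * c ^ n)"
    by (simp only: power_mult_distrib power_mult[symmetric] mult_ac)
  moreover have "(C * \<rho>) ^ (a + n) = \<rho> ^ (n * (n - 1)) * (C ^ (a + n) * \<rho> ^ m)"
    unfolding power_mult_distrib by (simp only: an power_add mult_ac)
  ultimately have "\<rho> ^ (n * (n - 1)) * (S * c ^ n) \<le> \<rho> ^ (n * (n - 1)) * (C ^ (a + n) * \<rho> ^ m)"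
    by (simp only:)
  then have "S * c ^ n \<le> C ^ (a + n) * \<rho> ^ m"
    by (rule mult_left_le_imp_le) (use pos in simp)
  also have "\<dots> \<le> C ^ (a + n) * \<rho> ^ 1"
    using pos m by (intro mult_left_mono power_decreasing) auto
  finally show ?thesis by simp
qed

lemma moment_le_perimeter:
  fixes E :: "(real ^ 'n) set"
  assumes "E \<subseteq> cball 0 1"
  shows "moment E 0 \<le> perimeter E"
proof -
  have fr: "frontier E \<subseteq> cball 0 1"
    using closure_minimal[OF assms closed_cball] by (auto simp: frontier_def)
  have "moment E 0 \<le> (\<integral>\<^sup>+x\<in>frontier E. 1 \<partial>hausdorff_measure (CARD('n) - 1))"
    unfolding moment_def
    using fr by (intro nn_integral_mono) (auto simp: indicator_def power_le_one)
  then show ?thesis by (simp add: perimeter_def borel_closed)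
qed

text \<open>
  The number \<open>\<rho>\<close> is the inradius. A ball of radius slightly less than \<open>\<rho>\<close> gives the lower bound,
  and the absence of a ball of radius \<open>2 \<rho>\<close> gives the upper one.
\<close>

lemma obtain_inradius:
  fixes E :: "(real ^ 'n) set"
  assumes E: "open E" "convex E" "E \<noteq> {}" "E \<subseteq> cball 0 1"
    and pq: "p \<in> E" "q \<in> E" "dist p q \<ge> 1 / 2"
  obtains \<rho> where "0 < \<rho>" "\<rho> \<le> 1"
    "ennreal (unit_ball_vol (real CARD('n)) * (\<rho> / 8) ^ CARD('n) / (2 * \<rho>)) \<le> emeasure lborel E"
    "emeasure lborel E \<le> ennreal (4 ^ CARD('n) / unit_ball_vol (real (CARD('n) - 1))
       * (CARD('n) * (real (CARD('n) + 1) * (2 * \<rho>)))) * perimeter E"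
proof -
  let ?S = "closure E"
  have bE: "bounded E" using E(4) bounded_cball bounded_subset by blast
  have S: "compact ?S" "convex ?S" "?S \<noteq> {}" using E bE by (auto simp: compact_closure)
  have S1: "?S \<subseteq> cball 0 1" using closure_minimal[OF E(4) closed_cball] .
  have intS: "interior ?S = E" using E by (simp add: convex_interior_closure interior_open)
  define R where "R = {r. r > 0 \<and> (\<exists>z. cball z r \<subseteq> ?S)}"
  have Rle: "r \<le> 1" if r: "r \<in> R" for r
  proof -
    obtain z where "cball z r \<subseteq> ?S" "r > 0" using r by (auto simp: R_def)
    then have z: "cball z r \<subseteq> cball 0 1" "r > 0" using S1 by blast+
    then have "dist z 0 + r \<le> 1" by (auto simp: cball_subset_cball_iff)
    then show ?thesis using zero_le_dist[of z 0] by linarith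
  qed
  then have bdd: "bdd_above R" by (auto simp: bdd_above_def)
  obtain x e where "e > 0" "cball x e \<subseteq> E" using E by (metis all_not_in_conv open_contains_cball)
  then have eR: "e \<in> R" using closure_subset[of E] by (auto simp: R_def)
  define \<rho> where "\<rho> = Sup R"
  have "e \<le> \<rho>" unfolding \<rho>_def using eR bdd by (rule cSup_upper)
  then have \<rho>: "\<rho> > 0" using \<open>e > 0\<close> by simp
  have \<rho>1: "\<rho> \<le> 1" unfolding \<rho>_def using eR Rle by (intro cSup_least) auto
  have "\<rho> / 2 < Sup R" using \<rho> by (simp add: \<rho>_def)
  then obtain r where r: "r \<in> R" "\<rho> / 2 < r" using less_cSupD eR by blast
  then obtain z where z: "cball z r \<subseteq> ?S" by (auto simp: R_def)
  have "ball z r \<subseteq> interior ?S"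
    using z ball_subset_cball[of z r] by (intro interior_maximal) auto
  then have "cball z (\<rho> / 4) \<subseteq> E"
    unfolding intS using r \<rho> by (auto simp: subset_eq)
  moreover obtain q' where "q' \<in> E" "dist z q' \<ge> 1 / 4"
  proof (cases "dist z p \<ge> 1 / 4")
    case False
    then have "dist z q \<ge> 1 / 4"
      using dist_triangle[of p q z] pq(3) by (simp add: dist_commute)
    then show ?thesis using pq that by blast
  qed (use pq that in blast)
  ultimately have low: "ennreal (unit_ball_vol (real DIM(real ^ 'n)) * (\<rho> / 4 / 2) ^ DIM(real ^ 'n) / (8 * (\<rho> / 4))) \<le> emeasure lborel E"
    using E \<rho> by (intro emeasure_ge_ball_and_point[of E "\<rho> / 4" z q']) auto
  have "2 * \<rho> \<notin> R" using cSup_upper[OF _ bdd, of "2 * \<rho>"] \<rho> by (auto simp: \<rho>_def)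
  then have "\<not> cball z (2 * \<rho>) \<subseteq> ?S" for z using \<rho> by (auto simp: R_def)
  then obtain u where u: "norm u = 1"
    "\<And>x y. x \<in> ?S \<Longrightarrow> y \<in> ?S \<Longrightarrow> u \<bullet> (x - y) \<le> real (DIM(real ^ 'n) + 1) * (2 * \<rho>)"
    using inscribed_ball_or_thin[OF S, of "2 * \<rho>"] by metis
  have "emeasure lborel E \<le> ennreal (4 ^ CARD('n) / unit_ball_vol (real (CARD('n) - 1))
       * (CARD('n) * (real (DIM(real ^ 'n) + 1) * (2 * \<rho>)))) * perimeter E"
    using \<rho> by (intro emeasure_le_width_times_perimeter[OF E(1) bE _ u]) auto
  with low show ?thesis using \<rho> \<rho>1 by (intro that[of \<rho>]) auto
qed

lemma emeasure_open_pos: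
  fixes E :: "'a::euclidean_space set"
  assumes E: "open E" "E \<noteq> {}"
  shows "emeasure lborel E > 0"
proof -
  obtain x e where e: "e > 0" "cball x e \<subseteq> E" using E by (metis all_not_in_conv open_contains_cball)
  have "0 < emeasure lborel (cball x e)" using e by (simp add: emeasure_cball ennreal_less_zero_iff)
  also have "\<dots> \<le> emeasure lborel E" using e E by (intro emeasure_mono) auto
  finally show ?thesis .
qed

lemma perimeter_pos:
  fixes E :: "(real ^ 'n) set"
  assumes E: "open E" "bounded E" "E \<noteq> {}"
  shows "perimeter E > 0"
proof (rule ccontr)
  assume "\<not> ?thesis"
  then have P: "perimeter E = 0" by simp
  let ?u = "axis undefined 1 :: real ^ 'n"
  have c: "?u \<bullet> (x - y) \<le> diameter (closure E) + 1" if xy: "x \<in> closure E" "y \<in> closure E" for x y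
    using norm_cauchy_schwarz[of ?u "x - y"] diameter_bounded_bound[of "closure E" x y] E(2) xy
    by (simp add: dist_norm bounded_closure)
  have "diameter (closure E) \<ge> 0" using E by (intro diameter_ge_0 bounded_closure)
  then have "emeasure lborel E \<le> 0"
    using emeasure_le_width_times_perimeter[OF E(1,2) _ _ c]
    by (simp add: P)
  then show False using emeasure_open_pos[OF E(1,3)] by simp
qed

text \<open>
  A body with infinite perimeter has value \<open>0\<close>, so a positive lower bound on the functional makes all
  quantities finite. The arithmetic above then bounds the inradius, and with it
  the volume, from below.
\<close>

lemma volume_ge_if_shape_functional_ge:
  fixes S :: real
  assumes n: "CARD('n) \<ge> 3" and S: "S > 0"
  shows "\<exists>v>0. \<forall>E :: (real ^ 'n) set. open E \<and> convex E \<and> E \<subseteq> cball 0 1 \<and>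
     (\<exists>p\<in>E. \<exists>q\<in>E. dist p q \<ge> 1 / 2) \<and> ennreal S \<le> shape_functional E \<longrightarrow> ennreal v \<le> emeasure lborel E"
proof -
  let ?n = "CARD('n)"
  define a where "a = (?n - 2) * (?n + 1)"
  define b where "b = ?n\<^sup>2 - 1"
  define C where "C = 4 ^ ?n / unit_ball_vol (real (?n - 1)) * (?n * (real (?n + 1) * 2))"
  define c where "c = unit_ball_vol (real ?n) * (1 / 8) ^ ?n / 2"
  have C: "C > 0" using n by (simp add: C_def)
  have c: "c > 0" by (simp add: c_def)
  define v where "v = c * (S * c ^ ?n / C ^ (a + ?n)) ^ (?n - 1)"
  have "v > 0" using C c S by (simp add: v_def)
  moreover have "ennreal v \<le> emeasure lborel E"
    if E: "open E" "convex E" "E \<subseteq> cball 0 1" and pq: "p \<in> E" "q \<in> E" "dist p q \<ge> 1 / 2"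
      and F: "ennreal S \<le> shape_functional E" for E :: "(real ^ 'n) set" and p q
  proof -
    have ne: "E \<noteq> {}" and bE: "bounded E" using pq E(3) bounded_cball bounded_subset by blast+
    define V where "V = measure lborel E"
    have V: "emeasure lborel E = ennreal V"
      unfolding V_def using emeasure_bounded_finite[OF bE] by (intro emeasure_eq_ennreal_measure) auto
    have V0: "V > 0" using emeasure_open_pos[OF E(1) ne] V by (simp add: ennreal_less_zero_iff)
    have w: "(INF x. moment E x) \<le> perimeter E"
      using moment_le_perimeter[OF E(3)] by (meson INF_lower UNIV_I order_trans)
    have "perimeter E \<noteq> top"
    proof
      assume "perimeter E = top"
      then have "shape_functional E = 0"
        using mult_le_mono[OF n n] by (simp add: shape_functional_moment power_eq_top_ennreal power2_eq_square)
      then show False using F S by simp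
    qed
    then obtain P where P: "perimeter E = ennreal P" "P \<ge> 0" by (cases "perimeter E") auto
    then have P0: "P > 0" using perimeter_pos[OF E(1) bE ne] by (simp add: ennreal_less_zero_iff)
    have "ennreal S \<le> ennreal V ^ a / ennreal P ^ b * ennreal P"
      using F w unfolding shape_functional_moment a_def[symmetric] b_def[symmetric] V P
      by (meson mult_left_mono order_trans zero_le)
    also have "\<dots> = ennreal (V ^ a / P ^ b * P)"
      using V0 P0 by (simp add: ennreal_power divide_ennreal ennreal_mult[symmetric])
    finally have SV: "S \<le> V ^ a / P ^ b * P" using V0 P0 by (simp add: ennreal_le_iff)
    obtain \<rho> where \<rho>: "0 < \<rho>" "\<rho> \<le> 1"
      and low: "ennreal (unit_ball_vol (real ?n) * (\<rho> / 8) ^ ?n / (2 * \<rho>)) \<le> emeasure lborel E"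
      and up: "emeasure lborel E \<le> ennreal (4 ^ ?n / unit_ball_vol (real (?n - 1))
         * (?n * (real (?n + 1) * (2 * \<rho>)))) * perimeter E"
      using obtain_inradius[OF E(1,2) ne E(3) pq] by blast
    have "(\<rho> / 8) ^ ?n = (1 / 8) ^ ?n * (\<rho> ^ (?n - 1) * \<rho>)"
      using n power_minus_mult[of ?n \<rho>] by (simp add: power_divide)
    then have "unit_ball_vol (real ?n) * (\<rho> / 8) ^ ?n / (2 * \<rho>) = c * \<rho> ^ (?n - 1)"
      using \<rho> by (simp add: c_def)
    then have low': "c * \<rho> ^ (?n - 1) \<le> V" using low V V0 by (simp add: ennreal_le_iff)
    have "4 ^ ?n / unit_ball_vol (real (?n - 1)) * (?n * (real (?n + 1) * (2 * \<rho>))) = C * \<rho>"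
      by (simp add: C_def)
    then have up': "V \<le> C * \<rho> * P"
      using up P P0 C \<rho> by (simp add: V ennreal_mult[symmetric] ennreal_le_iff)
    have "S * c ^ ?n \<le> C ^ (a + ?n) * \<rho>"
      unfolding a_def
      by (rule inradius_ge_arith[OF n V0 P0 \<rho> C c _ up' low'])
        (use S SV in \<open>simp_all add: a_def b_def\<close>)
    then have "S * c ^ ?n / C ^ (a + ?n) \<le> \<rho>"
      using C by (simp add: pos_divide_le_eq mult.commute)
    then have "v \<le> c * \<rho> ^ (?n - 1)"
      unfolding v_def using S C c by (intro mult_left_mono power_mono) auto
    then show ?thesis using low' by (simp add: V ennreal_leI)
  qed
  ultimately show ?thesis by blast
qed



section \<open>Selection of a convergent subsequence\<close>

lemma infdist_convex_combination:
  fixes E :: "'a::real_normed_vector set"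
  assumes E: "convex E" "E \<noteq> {}" and st: "s \<ge> 0" "t \<ge> 0" "s + t = 1"
    and d: "infdist x E < d" "infdist y E < d"
  shows "infdist (s *\<^sub>R x + t *\<^sub>R y) E \<le> d"
proof -
  obtain x' y' where x': "x' \<in> E" "dist x x' < d" and y': "y' \<in> E" "dist y y' < d"
    using d E by (auto simp: infdist_notempty cINF_less_iff)
  have "dist (s *\<^sub>R x + t *\<^sub>R y) (s *\<^sub>R x' + t *\<^sub>R y') = norm (s *\<^sub>R (x - x') + t *\<^sub>R (y - y'))"
    by (simp add: dist_norm algebra_simps)
  also have "\<dots> \<le> s * norm (x - x') + t * norm (y - y')"
    by (rule norm_triangle_le) (use st in simp)
  also have "\<dots> \<le> s * d + t * d"
    using x' y' st by (intro add_mono mult_left_mono) (auto simp: dist_norm)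
  also have "\<dots> = d" using st by (simp flip: distrib_right)
  finally show ?thesis
    using infdist_le2[of "s *\<^sub>R x' + t *\<^sub>R y'" E] E x' y' st by (simp add: convexD)
qed

text \<open>
  The distance functions of the sets are uniformly bounded and 1-Lipschitz on the ball, so a
  subsequence converges uniformly to some \<open>g\<close>, and \<open>K\<close> is the zero set of \<open>g\<close>. The two halves
  of Hausdorff convergence are stated in the forms in which they are used. For the second, \<open>g\<close>
  has a positive minimum on the part of the ball outside \<open>U\<close>, so sets whose distance
  function is uniformly close to \<open>g\<close> cannot meet it.
\<close>

lemma Blaschke_selection:
  fixes E :: "nat \<Rightarrow> 'a::euclidean_space set"
  assumes E: "\<And>k. convex (E k)" "\<And>k. E k \<noteq> {}" "\<And>k. E k \<subseteq> cball 0 R"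
  obtains K r where "strict_mono r" "compact K" "convex K" "K \<subseteq> cball 0 R"
    "\<And>\<epsilon>. \<epsilon> > 0 \<Longrightarrow> \<forall>\<^sub>F k in sequentially. \<forall>x\<in>K. infdist x (E (r k)) \<le> \<epsilon>"
    "\<And>U. open U \<Longrightarrow> K \<subseteq> U \<Longrightarrow> \<forall>\<^sub>F k in sequentially. E (r k) \<subseteq> U"
proof -
  let ?S = "cball (0::'a) R"
  have bound: "norm (infdist x (E k)) \<le> 2 * R" if x: "x \<in> ?S" for k x
  proof -
    obtain y where y: "y \<in> E k" using E(2) by blast
    have "infdist x (E k) \<le> dist x y" using y by (rule infdist_le)
    also have "\<dots> \<le> norm x + norm y" by (simp add: dist_norm norm_triangle_ineq4)
    also have "\<dots> \<le> 2 * R" using x y E(3)[of k] by auto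
    finally show ?thesis by (simp add: infdist_nonneg)
  qed
  have equi: "\<exists>d. 0 < d \<and> (\<forall>k y. y \<in> ?S \<and> norm (x - y) < d \<longrightarrow> norm (infdist x (E k) - infdist y (E k)) < e)"
    if "0 < e" for x e
  proof (intro exI[of _ e] conjI allI impI)
    fix k y assume "y \<in> ?S \<and> norm (x - y) < e"
    then show "norm (infdist x (E k) - infdist y (E k)) < e"
      using infdist_triangle_abs[of x "E k" y] by (simp add: dist_norm)
  qed (rule that)
  obtain g r where g: "continuous_on ?S g" and r: "strict_mono (r :: nat \<Rightarrow> nat)"
    and lim: "\<And>e. 0 < e \<Longrightarrow> \<exists>N. \<forall>k x. k \<ge> N \<and> x \<in> ?S \<longrightarrow> norm (infdist x (E (r k)) - g x) < e"
    by (rule Arzela_Ascoli[of ?S "\<lambda>k x. infdist x (E k)" "2 * R", OF compact_cball bound equi]) blast+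
  have lim': "\<forall>\<^sub>F k in sequentially. \<forall>x\<in>?S. \<bar>infdist x (E (r k)) - g x\<bar> < e" if e: "e > 0" for e
  proof -
    obtain N where "\<forall>k x. k \<ge> N \<and> x \<in> ?S \<longrightarrow> norm (infdist x (E (r k)) - g x) < e"
      using lim[OF e] by blast
    then show ?thesis
      unfolding eventually_sequentially by (intro exI[of _ N]) simp
  qed
  define K where "K = {x \<in> ?S. g x \<le> 0}"
  have "closed K"
    unfolding K_def using continuous_on_closed_Collect_le[OF g continuous_on_const closed_cball, of 0] by simp
  moreover have "bounded K"
    by (rule bounded_subset[OF bounded_cball[of 0 R]]) (auto simp: K_def)
  ultimately have "compact K" by (simp add: compact_eq_bounded_closed)
  moreover have "convex K"
  proof (rule convexI)
    fix x y and s t :: real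
    assume xy: "x \<in> K" "y \<in> K" and st: "s \<ge> 0" "t \<ge> 0" "s + t = 1"
    let ?w = "s *\<^sub>R x + t *\<^sub>R y"
    have w: "?w \<in> ?S" using xy st by (intro convexD[OF convex_cball]) (auto simp: K_def)
    have "g ?w \<le> e" if e: "e > 0" for e
    proof -
      have "\<forall>\<^sub>F k in sequentially. \<forall>x\<in>?S. \<bar>infdist x (E (r k)) - g x\<bar> < e / 2"
        using e by (intro lim') simp
      then obtain k where k: "\<And>x. x \<in> ?S \<Longrightarrow> \<bar>infdist x (E (r k)) - g x\<bar> < e / 2"
        using eventually_happens'[OF sequentially_bot] by blast
      have "infdist x (E (r k)) < e / 2" "infdist y (E (r k)) < e / 2"
        using k[of x] k[of y] xy unfolding K_def mem_Collect_eq by linarith+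
      then have "infdist ?w (E (r k)) \<le> e / 2"
        using E st by (intro infdist_convex_combination) auto
      then show ?thesis using k[OF w] by linarith
    qed
    then have "g ?w \<le> 0" by (rule field_le_epsilon[of _ 0, simplified])
    then show "?w \<in> K" using w by (simp add: K_def)
  qed
  moreover have "\<forall>\<^sub>F k in sequentially. \<forall>x\<in>K. infdist x (E (r k)) \<le> \<epsilon>" if "\<epsilon> > 0" for \<epsilon>
    using lim'[OF that]
  proof eventually_elim
    case (elim k)
    show ?case
    proof
      fix x assume "x \<in> K"
      then have "x \<in> ?S" "g x \<le> 0" by (auto simp: K_def)
      then show "infdist x (E (r k)) \<le> \<epsilon>" using elim by force
    qed
  qed
  moreover have "\<forall>\<^sub>F k in sequentially. E (r k) \<subseteq> U" if U: "open U" "K \<subseteq> U" for U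
  proof (cases "?S - U = {}")
    case True
    then show ?thesis using E(3) by (intro always_eventually allI) blast
  next
    case False
    have "compact (?S - U)" using U by (intro compact_diff compact_cball)
    moreover have "continuous_on (?S - U) g" using g by (rule continuous_on_subset) auto
    ultimately obtain x0 where x0: "x0 \<in> ?S - U" "\<And>x. x \<in> ?S - U \<Longrightarrow> g x0 \<le> g x"
      using continuous_attains_inf[of "?S - U" g] False by metis
    have "g x0 > 0" using x0(1) U by (auto simp: K_def)
    from lim'[OF this] show ?thesis
    proof eventually_elim
      case (elim k)
      show ?case
      proof (rule ccontr)
        assume "\<not> ?case"
        then obtain x where x: "x \<in> E (r k)" "x \<notin> U" by blast
        then have "x \<in> ?S - U" using E(3) by blast
        then have "\<bar>infdist x (E (r k)) - g x\<bar> < g x0" "g x0 \<le> g x" using elim x0(2) by auto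
        moreover have "infdist x (E (r k)) = 0" using x by simp
        ultimately show False by linarith
      qed
    qed
  qed
  ultimately show ?thesis using r by (intro that[of r K]) (auto simp: K_def)
qed

text \<open>
  If \<open>x\<close> lies outside the closure of \<open>C\<close>, then moving from \<open>x\<close> by \<open>\<epsilon>\<close> away from its nearest point in that closure
  gives a point \<open>q\<close> of the ball whose distance to \<open>C\<close> exceeds \<open>\<epsilon>\<close>.
\<close>

lemma mem_closure_if_ball_near:
  fixes C :: "'a::euclidean_space set"
  assumes C: "convex C" "C \<noteq> {}" and near: "\<And>q. q \<in> cball x \<epsilon> \<Longrightarrow> infdist q C \<le> \<epsilon>" and "\<epsilon> \<ge> 0"
  shows "x \<in> closure C"
proof (rule ccontr)
  assume x: "x \<notin> closure C"
  define y where "y = closest_point (closure C) x"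
  have y: "y \<in> closure C" unfolding y_def using C by (intro closest_point_in_set) auto
  define u where "u = (x - y) /\<^sub>R norm (x - y)"
  have xy: "norm (x - y) > 0" using x y by auto
  then have u: "norm u = 1" "u \<bullet> (x - y) = norm (x - y)" 
    by (simp_all add: u_def dot_square_norm power2_eq_square)
  define q where "q = x + \<epsilon> *\<^sub>R u"
  have "\<epsilon> + norm (x - y) \<le> dist q c" if c: "c \<in> C" for c
  proof -
    have "(x - y) \<bullet> (c - y) \<le> 0"
      unfolding y_def using C c closure_subset by (intro closest_point_dot) auto
    then have "u \<bullet> (c - y) \<le> 0" using xy by (simp add: u_def mult_nonneg_nonpos)
    have "u \<bullet> (q - c) = u \<bullet> (x - y) + \<epsilon> * (u \<bullet> u) - u \<bullet> (c - y)"
      by (simp add: q_def inner_diff_right inner_add_right)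
    also have "u \<bullet> u = 1" using u by (simp add: dot_square_norm)
    finally have "\<epsilon> + norm (x - y) \<le> u \<bullet> (q - c)" using u \<open>u \<bullet> (c - y) \<le> 0\<close> by simp
    also have "\<dots> \<le> dist q c" using norm_cauchy_schwarz[of u "q - c"] u by (simp add: dist_norm)
    finally show ?thesis .
  qed
  then have "\<epsilon> + norm (x - y) \<le> infdist q C"
    using C by (simp add: infdist_notempty cINF_greatest)
  moreover have "infdist q C \<le> \<epsilon>" using u \<open>\<epsilon> \<ge> 0\<close> by (intro near) (simp add: q_def dist_norm)
  ultimately show False using xy by simp
qed

text \<open>
  Shrinking \<open>K\<close> about \<open>z\<close> by the factor \<open>1 - \<theta>\<close> leaves room for a ball of radius \<open>\<theta> \<rho>\<close> around each
  point inside \<open>K\<close>; this absorbs the distance between \<open>K\<close> and \<open>E\<close>.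
\<close>

lemma shrink_into_closure:
  fixes K E :: "'a::euclidean_space set"
  assumes K: "convex K" "cball z \<rho> \<subseteq> K" and E: "convex E" "E \<noteq> {}"
    and \<theta>: "0 \<le> \<theta>" "\<theta> \<le> 1" and \<rho>: "\<rho> > 0"
    and near: "\<And>q. q \<in> K \<Longrightarrow> infdist q E \<le> \<theta> * \<rho>" and x: "x \<in> K"
  shows "z + (1 - \<theta>) *\<^sub>R (x - z) \<in> closure E"
proof (rule mem_closure_if_ball_near[OF E, of _ "\<theta> * \<rho>"])
  fix q assume q: "q \<in> cball (z + (1 - \<theta>) *\<^sub>R (x - z)) (\<theta> * \<rho>)"
  have "q \<in> K"
  proof (cases "\<theta> = 0")
    case True
    then show ?thesis using q x by simp
  next
    case False
    define p where "p = z + (1 / \<theta>) *\<^sub>R (q - (z + (1 - \<theta>) *\<^sub>R (x - z)))"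
    have "norm (q - (z + (1 - \<theta>) *\<^sub>R (x - z))) \<le> \<theta> * \<rho>"
      using q by (simp add: dist_norm norm_minus_commute)
    then have "dist z p \<le> \<rho>"
      using \<theta> False by (simp add: p_def dist_norm pos_divide_le_eq mult.commute)
    then have "p \<in> K" using K by auto
    then have "(1 - \<theta>) *\<^sub>R x + \<theta> *\<^sub>R p \<in> K"
      using K x \<theta> by (intro convexD) auto
    also have "\<theta> *\<^sub>R p = \<theta> *\<^sub>R z + (q - (z + (1 - \<theta>) *\<^sub>R (x - z)))"
      using False by (simp add: p_def scaleR_add_right)
    also have "(1 - \<theta>) *\<^sub>R x + (\<theta> *\<^sub>R z + (q - (z + (1 - \<theta>) *\<^sub>R (x - z)))) = q"
      by (simp add: algebra_simps)
    finally show ?thesis .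
  qed
  then show "infdist q E \<le> \<theta> * \<rho>" by (rule near)
qed (use \<theta> \<rho> in auto)



section \<open>Upper semicontinuity\<close>

text \<open>
  Here \<open>\<tau>\<close> is the dilation about \<open>z\<close> with ratio \<open>1 + \<theta>\<close>. The comparison map sends a boundary point
  \<open>x\<close> of \<open>G\<close> to the point of \<open>E\<close> nearest to \<open>\<tau> x\<close>. Since \<open>E\<close> has a limit point close to \<open>x\<close>, this
  displaces \<open>x\<close> by at most \<open>6 \<theta>\<close>, and \<open>(s + 6 \<theta>)\<^sup>2 \<le> (1 + 6 \<theta>) s\<^sup>2 + 42 \<theta>\<close>.
\<close>

lemma moment_le_of_dilates:
  fixes E G :: "(real ^ 'n) set"
  assumes E: "convex E" "interior E \<noteq> {}" and G: "bounded G" and \<theta>: "0 < \<theta>" "\<theta> < 1"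
    and EG: "E \<subseteq> (\<lambda>x. (- \<theta>) *\<^sub>R z + (1 + \<theta>) *\<^sub>R x) ` G"
    and GE: "\<And>x. x \<in> frontier G \<Longrightarrow> z + (1 - \<theta>) *\<^sub>R (x - z) \<in> closure E"
    and diam: "\<And>x. x \<in> frontier G \<Longrightarrow> norm (x - z) \<le> 2"
  shows "moment E x\<^sub>0 \<le> ennreal ((1 + \<theta>) ^ (CARD('n) - 1)) *
    (ennreal (1 + 6 * \<theta>) * moment G x\<^sub>0 + ennreal (42 * \<theta>) * perimeter G)"
proof -
  let ?H = "hausdorff_measure (CARD('n) - 1) :: (real ^ 'n) measure"
  let ?\<tau> = "\<lambda>x. (- \<theta>) *\<^sub>R z + (1 + \<theta>) *\<^sub>R x"
  have [measurable]: "frontier G \<in> sets borel" by (simp add: borel_closed)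
  have pt: "ennreal ((norm (closest_point (closure E) (?\<tau> x) - x\<^sub>0))\<^sup>2)
      \<le> ennreal (1 + 6 * \<theta>) * ennreal ((norm (x - x\<^sub>0))\<^sup>2) + ennreal (42 * \<theta>)"
    if x: "x \<in> frontier G" for x
  proof -
    let ?y = "z + (1 - \<theta>) *\<^sub>R (x - z)" and ?p = "closest_point (closure E) (?\<tau> x)"
    have "E \<noteq> {}" using E by auto
    have "dist ?p ?y = dist ?p (closest_point (closure E) ?y)"
      using GE[OF x] by (simp add: closest_point_self)
    also have "\<dots> \<le> dist (?\<tau> x) ?y"
      using E \<open>E \<noteq> {}\<close> by (intro closest_point_lipschitz) auto
    also have "?\<tau> x - ?y = (2 * \<theta>) *\<^sub>R (x - z)"
      by (simp add: vec_eq_iff algebra_simps)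
    then have "dist (?\<tau> x) ?y = 2 * \<theta> * norm (x - z)"
      using \<theta> by (simp add: dist_norm)
    finally have "dist ?p ?y \<le> 2 * \<theta> * norm (x - z)" .
    moreover have "?y - x = (- \<theta>) *\<^sub>R (x - z)" by (simp add: algebra_simps)
    then have "dist ?y x = \<theta> * norm (x - z)" using \<theta> by (simp add: dist_norm)
    moreover have "dist ?p x \<le> dist ?p ?y + dist ?y x" by (rule dist_triangle)
    moreover have "\<theta> * norm (x - z) \<le> \<theta> * 2" using diam[OF x] \<theta> by (intro mult_left_mono) auto
    ultimately have px: "norm (?p - x) \<le> 6 * \<theta>" by (simp add: dist_norm)
    define s where "s = norm (x - x\<^sub>0)"
    have "norm (?p - x\<^sub>0) \<le> s + 6 * \<theta>"
      using norm_triangle_ineq[of "?p - x" "x - x\<^sub>0"] px by (simp add: s_def)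
    then have "(norm (?p - x\<^sub>0))\<^sup>2 \<le> (s + 6 * \<theta>)\<^sup>2" by (intro power_mono) auto
    also have "\<dots> \<le> (1 + 6 * \<theta>) * s\<^sup>2 + 42 * \<theta>"
    proof -
      have "0 \<le> 6 * \<theta> * (s - 1)\<^sup>2" using \<theta> by simp
      moreover have "\<theta> * \<theta> \<le> \<theta> * 1" using \<theta> by (intro mult_left_mono) auto
      ultimately show ?thesis by (simp add: power2_eq_square algebra_simps)
    qed
    finally show ?thesis
      using \<theta> unfolding s_def by (simp add: ennreal_mult[symmetric] ennreal_plus[symmetric] ennreal_leI del: ennreal_plus)
  qed
  have "moment E x\<^sub>0 \<le> ennreal ((1 + \<theta>) ^ (CARD('n) - 1)) *
      (\<integral>\<^sup>+x\<in>frontier G. ennreal ((norm (closest_point (closure E) (?\<tau> x) - x\<^sub>0))\<^sup>2) \<partial>?H)"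
    unfolding moment_def using \<theta> by (intro nn_integral_frontier_le[OF E G _ EG]) auto
  also have "\<dots> \<le> ennreal ((1 + \<theta>) ^ (CARD('n) - 1)) *
      (\<integral>\<^sup>+x. ennreal (1 + 6 * \<theta>) * (ennreal ((norm (x - x\<^sub>0))\<^sup>2) * indicator (frontier G) x)
         + ennreal (42 * \<theta>) * indicator (frontier G) x \<partial>?H)"
    using pt by (intro mult_left_mono nn_integral_mono) (auto simp: indicator_def)
  also have "(\<integral>\<^sup>+x. ennreal (1 + 6 * \<theta>) * (ennreal ((norm (x - x\<^sub>0))\<^sup>2) * indicator (frontier G) x)
         + ennreal (42 * \<theta>) * indicator (frontier G) x \<partial>?H)
      = ennreal (1 + 6 * \<theta>) * moment G x\<^sub>0 + ennreal (42 * \<theta>) * perimeter G"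
    unfolding moment_def perimeter_def
    by (subst nn_integral_add) (auto simp: nn_integral_cmult)
  finally show ?thesis .
qed

text \<open>
  The perimeter bound is recorded separately because it also transfers finiteness of the perimeter
  from \<open>E\<close> to \<open>G\<close>.
\<close>

lemma shape_functional_le_of_dilates:
  fixes E G :: "(real ^ 'n) set"
  assumes E: "open E" "convex E" "E \<noteq> {}" "bounded E"
    and G: "open G" "convex G" "G \<noteq> {}" "bounded G" and \<theta>: "0 < \<theta>" "\<theta> < 1"
    and EG: "E \<subseteq> (\<lambda>x. (- \<theta>) *\<^sub>R z + (1 + \<theta>) *\<^sub>R x) ` G"
    and GE: "\<And>x. x \<in> closure G \<Longrightarrow> z + (1 - \<theta>) *\<^sub>R (x - z) \<in> closure E"
    and diam: "\<And>x. x \<in> frontier G \<Longrightarrow> norm (x - z) \<le> 2"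
  defines "n \<equiv> CARD('n)" defines "a \<equiv> (n - 2) * (n + 1)" and "b \<equiv> n\<^sup>2 - 1"
  shows "perimeter G \<le> ennreal ((1 / (1 - \<theta>)) ^ (n - 1)) * perimeter E"
    and "shape_functional E \<le> ennreal (((1 + \<theta>) ^ n) ^ a * ((1 / (1 - \<theta>)) ^ (n - 1)) ^ b) *
      (emeasure lborel G ^ a / perimeter G ^ b * (ennreal ((1 + \<theta>) ^ (n - 1)) *
        (ennreal (1 + 6 * \<theta>) * moment G x\<^sub>0 + ennreal (42 * \<theta>) * perimeter G)))"
proof -
  have intE: "interior E \<noteq> {}" and intG: "interior G \<noteq> {}" using E G by (simp_all add: interior_open)
  have "perimeter G \<le> ennreal ((1 / (1 - \<theta>)) ^ (n - 1)) * perimeter (closure E)"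
    unfolding n_def
  proof (rule perimeter_le[OF G(2) intG, of _ _ "(- \<theta> / (1 - \<theta>)) *\<^sub>R z"])
    show "G \<subseteq> (\<lambda>x. (- \<theta> / (1 - \<theta>)) *\<^sub>R z + (1 / (1 - \<theta>)) *\<^sub>R x) ` closure E"
    proof
      fix x assume "x \<in> G"
      then have y: "z + (1 - \<theta>) *\<^sub>R (x - z) \<in> closure E" using GE closure_subset by blast
      have "(- \<theta> / (1 - \<theta>)) *\<^sub>R z + (1 / (1 - \<theta>)) *\<^sub>R (z + (1 - \<theta>) *\<^sub>R (x - z))
          = (1 / (1 - \<theta>)) *\<^sub>R ((1 - \<theta>) *\<^sub>R x)"
        by (simp add: divide_inverse_commute scaleR_scaleR[symmetric] del: scaleR_scaleR flip: scaleR_add_right) (simp add: algebra_simps)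
      also have "\<dots> = x" using \<theta> by simp
      finally show "x \<in> (\<lambda>x. (- \<theta> / (1 - \<theta>)) *\<^sub>R z + (1 / (1 - \<theta>)) *\<^sub>R x) ` closure E"
        using y by (metis image_eqI)
    qed
  qed (use E \<theta> in \<open>auto simp: bounded_closure\<close>)
  then show P: "perimeter G \<le> ennreal ((1 / (1 - \<theta>)) ^ (n - 1)) * perimeter E"
    using E by (simp add: perimeter_def frontier_closure_convex)
  have "open ((\<lambda>x. (- \<theta>) *\<^sub>R z + (1 + \<theta>) *\<^sub>R x) ` G)"
    using \<theta> G(1) by (intro open_affinity) auto
  then have "emeasure lborel E \<le> emeasure lborel ((\<lambda>x. (- \<theta>) *\<^sub>R z + (1 + \<theta>) *\<^sub>R x) ` G)"
    using EG by (intro emeasure_mono) auto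
  also have "\<dots> = ennreal ((1 + \<theta>) ^ n) * emeasure lborel G"
    using \<open>open ((\<lambda>x. (- \<theta>) *\<^sub>R z + (1 + \<theta>) *\<^sub>R x) ` G)\<close> G \<theta>
    by (subst emeasure_lborel_affinity) (auto simp: n_def)
  finally have V: "emeasure lborel E \<le> ennreal ((1 + \<theta>) ^ n) * emeasure lborel G" .
  have "(INF x. moment E x) \<le> moment E x\<^sub>0" by (rule INF_lower) simp
  also have "\<dots> \<le> ennreal ((1 + \<theta>) ^ (n - 1)) *
        (ennreal (1 + 6 * \<theta>) * moment G x\<^sub>0 + ennreal (42 * \<theta>) * perimeter G)"
    unfolding n_def using GE by (intro moment_le_of_dilates[OF E(2) intE G(4) \<theta> EG _ diam]) (auto simp: frontier_def)
  finally show "shape_functional E \<le> ennreal (((1 + \<theta>) ^ n) ^ a * ((1 / (1 - \<theta>)) ^ (n - 1)) ^ b) *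
      (emeasure lborel G ^ a / perimeter G ^ b * (ennreal ((1 + \<theta>) ^ (n - 1)) *
        (ennreal (1 + 6 * \<theta>) * moment G x\<^sub>0 + ennreal (42 * \<theta>) * perimeter G)))"
    unfolding shape_functional_moment n_def[symmetric] a_def[symmetric] b_def[symmetric]
    using \<theta> by (intro power_quotient_le V P) auto
qed

lemma eventually_between_dilates:
  fixes E :: "nat \<Rightarrow> 'a::euclidean_space set"
  assumes E: "\<And>k. convex (E k)" "\<And>k. E k \<noteq> {}" and K: "convex K"
    and z: "z \<in> interior K" and \<theta>: "0 < \<theta>" "\<theta> < 1"
    and near: "\<And>\<epsilon>. \<epsilon> > 0 \<Longrightarrow> \<forall>\<^sub>F k in sequentially. \<forall>x\<in>K. infdist x (E k) \<le> \<epsilon>"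
    and sub: "\<And>U. open U \<Longrightarrow> K \<subseteq> U \<Longrightarrow> \<forall>\<^sub>F k in sequentially. E k \<subseteq> U"
  shows "\<forall>\<^sub>F k in sequentially. E k \<subseteq> (\<lambda>x. (- \<theta>) *\<^sub>R z + (1 + \<theta>) *\<^sub>R x) ` interior K \<and>
    (\<forall>x\<in>K. z + (1 - \<theta>) *\<^sub>R (x - z) \<in> closure (E k))"
proof -
  obtain \<rho> where \<rho>: "\<rho> > 0" "cball z \<rho> \<subseteq> K" using z by (meson mem_interior_cball)
  have "K \<subseteq> (\<lambda>x. (- \<theta>) *\<^sub>R z + (1 + \<theta>) *\<^sub>R x) ` interior K"
  proof
    fix x assume "x \<in> K"
    define e where "e = \<theta> / (1 + \<theta>)"
    have "x - e *\<^sub>R (x - z) \<in> interior K"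
      using \<theta> \<open>x \<in> K\<close> by (intro mem_interior_convex_shrink[OF K z]) (auto simp: e_def)
    moreover have "(1 + \<theta>) * e = \<theta>" using \<theta> by (simp add: e_def)
    then have "(1 + \<theta>) *\<^sub>R (x - e *\<^sub>R (x - z)) = (1 + \<theta>) *\<^sub>R x - \<theta> *\<^sub>R (x - z)"
      by (simp only: scaleR_diff_right[of "1 + \<theta>"] scaleR_scaleR)
    then have "x = (- \<theta>) *\<^sub>R z + (1 + \<theta>) *\<^sub>R (x - e *\<^sub>R (x - z))"
      by (simp add: algebra_simps)
    ultimately show "x \<in> (\<lambda>x. (- \<theta>) *\<^sub>R z + (1 + \<theta>) *\<^sub>R x) ` interior K" by blast
  qed
  moreover have "open ((\<lambda>x. (- \<theta>) *\<^sub>R z + (1 + \<theta>) *\<^sub>R x) ` interior K)"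
    using \<theta> by (intro open_affinity) auto
  ultimately have "\<forall>\<^sub>F k in sequentially. E k \<subseteq> (\<lambda>x. (- \<theta>) *\<^sub>R z + (1 + \<theta>) *\<^sub>R x) ` interior K"
    by (intro sub)
  moreover have "\<forall>\<^sub>F k in sequentially. \<forall>x\<in>K. infdist x (E k) \<le> \<theta> * \<rho>"
    using \<theta> \<rho> by (intro near) simp
  ultimately show ?thesis
  proof eventually_elim
    case (elim k)
    then show ?case
      using shrink_into_closure[OF K \<rho>(2) E(1,2), of \<theta> k] \<theta> \<rho> by auto
  qed
qed

text \<open>
  The previous bound for a fixed centre and a fixed \<open>\<theta>\<close> passes to the limit in \<open>k\<close>; afterwards \<open>\<theta>\<close>
  tends to \<open>0\<close>, and finally the infimum over the centres is taken. If \<open>S > 0\<close>, infinite perimeter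
  of the limit is excluded because it would force infinite perimeter, hence value
  \<open>0\<close>, along the sequence.
\<close>

lemma shape_functional_upper_semicontinuous:
  fixes E :: "nat \<Rightarrow> (real ^ 'n) set"
  assumes n: "CARD('n) \<ge> 2"
    and E: "\<And>k. open (E k)" "\<And>k. convex (E k)" "\<And>k. E k \<noteq> {}" "\<And>k. bounded (E k)"
    and K: "convex K" "compact K" "interior K \<noteq> {}" "K \<subseteq> cball 0 1"
    and near: "\<And>\<epsilon>. \<epsilon> > 0 \<Longrightarrow> \<forall>\<^sub>F k in sequentially. \<forall>x\<in>K. infdist x (E k) \<le> \<epsilon>"
    and sub: "\<And>U. open U \<Longrightarrow> K \<subseteq> U \<Longrightarrow> \<forall>\<^sub>F k in sequentially. E k \<subseteq> U"
    and lim: "(\<lambda>k. shape_functional (E k)) \<longlonglongrightarrow> S"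
  shows "S \<le> shape_functional (interior K)"
proof (cases "S = 0")
  case False
  then have S: "S > 0" by (simp add: zero_less_iff_neq_zero)
  define G where "G = interior K"
  have G: "open G" "convex G" "G \<noteq> {}" "bounded G"
    using K by (auto simp: G_def convex_interior bounded_interior compact_imp_bounded)
  have clG: "closure G \<subseteq> K"
    unfolding G_def using K by (intro closure_minimal interior_subset compact_imp_closed)
  obtain z where z: "z \<in> interior K" using K by auto
  have zK: "norm z \<le> 1" using z K(4) interior_subset[of K] by auto
  have diam: "norm (x - z) \<le> 2" if "x \<in> frontier G" for x
  proof -
    have "norm x \<le> 1" using that clG K(4) by (auto simp: frontier_def)
    then show ?thesis using norm_triangle_ineq4[of x z] zK by simp
  qed
  let ?n = "CARD('n)"
  define a where "a = (?n - 2) * (?n + 1)"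
  define b where "b = ?n\<^sup>2 - 1"
  have ev: "\<forall>\<^sub>F k in sequentially. E k \<subseteq> (\<lambda>x. (- \<theta>) *\<^sub>R z + (1 + \<theta>) *\<^sub>R x) ` interior K \<and>
      (\<forall>x\<in>K. z + (1 - \<theta>) *\<^sub>R (x - z) \<in> closure (E k))" if \<theta>: "0 < \<theta>" "\<theta> < 1" for \<theta>
    by (rule eventually_between_dilates[OF E(2,3) K(1) z \<theta>]) (fact near sub)+
  have bound: "\<forall>\<^sub>F k in sequentially. perimeter G \<le> ennreal ((1 / (1 - \<theta>)) ^ (?n - 1)) * perimeter (E k) \<and>
      (\<forall>x. shape_functional (E k) \<le> ennreal (((1 + \<theta>) ^ ?n) ^ a * ((1 / (1 - \<theta>)) ^ (?n - 1)) ^ b) *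
      (emeasure lborel G ^ a / perimeter G ^ b * (ennreal ((1 + \<theta>) ^ (?n - 1)) *
        (ennreal (1 + 6 * \<theta>) * moment G x + ennreal (42 * \<theta>) * perimeter G))))"
    if \<theta>: "0 < \<theta>" "\<theta> < 1" for \<theta>
    using ev[OF \<theta>]
  proof eventually_elim
    case (elim k)
    note sandwich = shape_functional_le_of_dilates[OF E(1-4)[of k] G \<theta>, of z, folded a_def b_def]
    from elim clG have "E k \<subseteq> (\<lambda>x. (- \<theta>) *\<^sub>R z + (1 + \<theta>) *\<^sub>R x) ` G"
      "\<And>x. x \<in> closure G \<Longrightarrow> z + (1 - \<theta>) *\<^sub>R (x - z) \<in> closure (E k)"
      by (auto simp: G_def)
    from sandwich[OF this diam] show ?case by blast
  qed
  have "perimeter G \<noteq> top"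
  proof
    assume top: "perimeter G = top"
    have "\<forall>\<^sub>F k in sequentially. shape_functional (E k) > 0"
      using lim S by (rule order_tendstoD)
    moreover have "\<forall>\<^sub>F k in sequentially. perimeter G \<le> ennreal ((1 / (1 - 1 / 2)) ^ (?n - 1)) * perimeter (E k)"
      using bound[of "1 / 2"] by (auto elim: eventually_mono)
    ultimately have "\<forall>\<^sub>F k in sequentially. False"
    proof eventually_elim
      case (elim k)
      then have "perimeter (E k) = top" using top by (auto simp: ennreal_mult_eq_top_iff top_unique)
      moreover have "0 < ?n\<^sup>2 - 1" using n mult_le_mono[OF n n] by (simp add: power2_eq_square)
      ultimately show False using elim by (simp add: shape_functional_moment)
    qed
    then show False by simp
  qed
  then obtain P where P: "perimeter G = ennreal P" "P \<ge> 0" by (cases "perimeter G") auto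
  have "perimeter G > 0" using G by (intro perimeter_pos)
  then have P0: "P > 0" using P by (simp add: ennreal_less_zero_iff)
  define V where "V = measure lborel G"
  have V: "emeasure lborel G = ennreal V"
    unfolding V_def using emeasure_bounded_finite[OF G(4)] by (intro emeasure_eq_ennreal_measure) auto
  have V0: "V > 0" using emeasure_open_pos[OF G(1,3)] V by (simp add: ennreal_less_zero_iff)
  have ratio: "emeasure lborel G ^ a / perimeter G ^ b = ennreal (V ^ a / P ^ b)"
    using V0 P0 by (simp add: V P ennreal_power divide_ennreal)
  have r0: "V ^ a / P ^ b > 0" using V0 P0 by simp
  have main: "S \<le> ennreal (V ^ a / P ^ b) * moment G x" for x
  proof (cases "moment G x = top")
    case True
    then show ?thesis using V0 P0 by (simp add: ennreal_mult_top)
  next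
    case False
    then obtain M where M: "moment G x = ennreal M" "M \<ge> 0" by (cases "moment G x") auto
    define h where "h \<theta> = ((1 + \<theta>) ^ ?n) ^ a * ((1 / (1 - \<theta>)) ^ (?n - 1)) ^ b *
      (V ^ a / P ^ b * ((1 + \<theta>) ^ (?n - 1) * ((1 + 6 * \<theta>) * M + 42 * \<theta> * P)))" for \<theta>
    have factor: "ennreal A * (ennreal Q * (ennreal B * (ennreal C * ennreal M + ennreal D * ennreal P)))
        = ennreal (A * (Q * (B * (C * M + D * P))))"
      if "A \<ge> 0" "Q \<ge> 0" "B \<ge> 0" "C \<ge> 0" "D \<ge> 0" "M \<ge> 0" "P \<ge> 0" for A Q B C D M P
      using that by (simp add: ennreal_mult ennreal_plus)
    have "S \<le> ennreal (h \<theta>)" if \<theta>: "0 < \<theta>" "\<theta> < 1" for \<theta>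
    proof (rule tendsto_upperbound[OF lim])
      show "\<forall>\<^sub>F k in sequentially. shape_functional (E k) \<le> ennreal (h \<theta>)"
        using bound[OF \<theta>]
      proof eventually_elim
        case (elim k)
        then have "shape_functional (E k) \<le> ennreal (((1 + \<theta>) ^ ?n) ^ a * ((1 / (1 - \<theta>)) ^ (?n - 1)) ^ b) *
          (ennreal (V ^ a / P ^ b) * (ennreal ((1 + \<theta>) ^ (?n - 1)) *
            (ennreal (1 + 6 * \<theta>) * ennreal M + ennreal (42 * \<theta>) * ennreal P)))"
          unfolding ratio[symmetric] M(1)[symmetric] P(1)[symmetric] by blast
        also have "\<dots> = ennreal (h \<theta>)"
          unfolding h_def by (rule factor) (use \<theta> r0 M P in auto)
        finally show ?case .
      qed
    qed simp
    moreover have "\<forall>\<^sub>F \<theta> in at_right 0. 0 < \<theta> \<and> \<theta> < (1::real)"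
      using eventually_at_right_real[of 0 "1::real"] by (auto elim: eventually_mono)
    ultimately have "\<forall>\<^sub>F \<theta> in at_right 0. S \<le> ennreal (h \<theta>)"
      by (auto elim: eventually_mono)
    moreover have "((\<lambda>\<theta>. ennreal (h \<theta>)) \<longlongrightarrow> ennreal (h 0)) (at_right 0)"
    proof (rule tendsto_ennrealI)
      have "isCont h 0" unfolding h_def by (intro continuous_intros) auto
      then show "(h \<longlongrightarrow> h 0) (at_right 0)"
        unfolding isCont_def by (rule tendsto_within_subset) simp
    qed
    ultimately have "S \<le> ennreal (h 0)"
      by (intro tendsto_lowerbound) auto
    also have "\<dots> = ennreal (V ^ a / P ^ b) * moment G x"
      using r0 M by (simp add: h_def ennreal_mult[symmetric])
    finally show ?thesis .
  qed
  have "S / ennreal (V ^ a / P ^ b) \<le> moment G x" for x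
    using main[of x] r0 by (intro divide_le_posI_ennreal) auto
  then have "S / ennreal (V ^ a / P ^ b) \<le> (INF x. moment G x)"
    by (rule INF_greatest)
  then have "S \<le> ennreal (V ^ a / P ^ b) * (INF x. moment G x)"
    using r0 by (intro ennreal_le_mult_if_divide_le)
  then show ?thesis
    unfolding G_def[symmetric] shape_functional_moment a_def[symmetric] b_def[symmetric] ratio .
qed simp



section \<open>Existence of a maximizer\<close>

lemma obtain_normalized_body:
  fixes E :: "(real ^ 'n) set"
  assumes n: "CARD('n) \<ge> 2" and E: "open E" "bounded E" "convex E" "E \<noteq> {}"
  obtains E' :: "(real ^ 'n) set" where "open E'" "convex E'" "E' \<subseteq> cball 0 1"
    "\<exists>p\<in>E'. \<exists>q\<in>E'. dist p q \<ge> 1 / 2" "shape_functional E \<le> shape_functional E'"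
proof -
  define d where "d = diameter E"
  obtain x e where e: "e > 0" "ball x e \<subseteq> E" using E by (metis all_not_in_conv openE)
  have "2 * e = diameter (ball x e)" using e by simp
  also have "\<dots> \<le> d" unfolding d_def by (rule diameter_subset[OF e(2) E(2)])
  finally have d: "d > 0" using e by simp
  obtain p0 where p0: "p0 \<in> E" using E by blast
  obtain p q where pq: "p \<in> E" "q \<in> E" "d / 2 < dist p q"
    using diameter_lower_bounded[OF E(2), of "d / 2"] d by (auto simp: d_def)
  define E' where "E' = (\<lambda>x. (- (1 / d)) *\<^sub>R p0 + (1 / d) *\<^sub>R x) ` E"
  have dist: "dist ((- (1 / d)) *\<^sub>R p0 + (1 / d) *\<^sub>R x) ((- (1 / d)) *\<^sub>R p0 + (1 / d) *\<^sub>R y) = dist x y / d" for x y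
    using d by (simp add: dist_norm flip: scaleR_diff_right)
  show ?thesis
  proof (rule that[of E'])
    show "open E'" unfolding E'_def using E d by (intro open_affinity) auto
    show "convex E'" unfolding E'_def using E by (intro convex_affinity)
    show "E' \<subseteq> cball 0 1"
    proof
      fix y assume "y \<in> E'"
      then obtain x where x: "x \<in> E" "y = (- (1 / d)) *\<^sub>R p0 + (1 / d) *\<^sub>R x" by (auto simp: E'_def)
      then have "norm y = dist x p0 / d" using dist[of x p0] by (simp add: dist_norm)
      also have "\<dots> \<le> 1"
        using diameter_bounded_bound[OF E(2) x(1) p0] d by (simp add: d_def)
      finally show "y \<in> cball 0 1" by simp
    qed
    show "\<exists>p\<in>E'. \<exists>q\<in>E'. dist p q \<ge> 1 / 2"
      unfolding E'_def
    proof (intro bexI imageI)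
      show "1 / 2 \<le> dist ((- (1 / d)) *\<^sub>R p0 + (1 / d) *\<^sub>R p) ((- (1 / d)) *\<^sub>R p0 + (1 / d) *\<^sub>R q)"
        unfolding dist using pq d by (simp add: field_simps)
    qed (use pq in auto)
    show "shape_functional E \<le> shape_functional E'"
      unfolding E'_def using E d by (intro shape_functional_affinity_le[OF n]) auto
  qed
qed

text \<open>
  A convex set without interior is a null set, so it has open neighbourhoods of volume below \<open>v\<close>,
  and these cannot contain any \<open>E k\<close>.
\<close>

lemma interior_nonempty_of_limit:
  fixes E :: "nat \<Rightarrow> 'a::euclidean_space set"
  assumes K: "convex K" "compact K" and v: "v > 0" "\<And>k. ennreal v \<le> emeasure lborel (E k)" and E: "\<And>k. open (E k)"
    and sub: "\<And>U. open U \<Longrightarrow> K \<subseteq> U \<Longrightarrow> \<forall>\<^sub>F k in sequentially. E k \<subseteq> U"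
  shows "interior K \<noteq> {}"
proof
  assume "interior K = {}"
  then have "negligible K" using negligible_convex_interior[OF K(1)] by simp
  then have null: "K \<in> sets lebesgue" "emeasure lebesgue K = 0"
    by (auto simp: negligible_iff_null_sets)
  obtain U where U: "open U" "K \<subseteq> U" "U - K \<in> lmeasurable" "emeasure lebesgue (U - K) < ennreal v"
    using sets_lebesgue_outer_open[OF null(1) v(1)] by metis
  obtain k where k: "E k \<subseteq> U"
    using eventually_happens'[OF sequentially_bot sub[OF U(1,2)]] by blast
  have "emeasure lborel (E k) = emeasure lebesgue (E k)" using E by simp
  also have "\<dots> \<le> emeasure lebesgue ((U - K) \<union> K)"
    using k by (intro emeasure_mono sets.Un[OF fmeasurableD[OF U(3)] null(1)]) auto
  also have "\<dots> \<le> emeasure lebesgue (U - K) + emeasure lebesgue K"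
    by (rule emeasure_subadditive[OF fmeasurableD[OF U(3)] null(1)])
  also have "\<dots> < ennreal v" using U(4) null(2) by simp
  finally show False using v(2)[of k] by simp
qed

theorem proposition4p5:
  assumes "CARD('n::finite) \<ge> 3"
  shows "\<exists>K :: (real ^ 'n) set.
           open K \<and> bounded K \<and> convex K \<and> interior K \<noteq> {} \<and>
           (SUP E \<in> {E :: (real ^ 'n) set. E \<noteq> {} \<and> open E \<and> bounded E \<and> convex E}.
              shape_functional E) = shape_functional K"
proof -
  define A where "A = {E :: (real ^ 'n) set. E \<noteq> {} \<and> open E \<and> bounded E \<and> convex E}"
  define S where "S = (SUP E\<in>A. shape_functional E)"
  have n: "CARD('n) \<ge> 2" using assms by simp
  have le_S: "shape_functional E \<le> S" if "E \<in> A" for E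
    unfolding S_def using that by (rule SUP_upper)
  have "ball 0 1 \<in> A" by (auto simp: A_def)
  have "\<exists>K\<in>A. S \<le> shape_functional K"
  proof (cases "S = 0")
    case True
    then show ?thesis using \<open>ball 0 1 \<in> A\<close> by auto
  next
    case False
    then have "S > 0" by (simp add: zero_less_iff_neq_zero)
    then obtain s where "0 < s" "s < S" using dense by blast
    moreover have "s < top" using \<open>s < S\<close> by (metis top_greatest order_less_le_trans)
    ultimately obtain S0 where S0: "S0 > 0" "ennreal S0 < S"
      by (cases s) (auto simp: ennreal_less_zero_iff)
    have "shape_functional ` A \<noteq> {}" using \<open>ball 0 1 \<in> A\<close> by blast
    then obtain f :: "nat \<Rightarrow> ennreal" where f: "incseq f" "range f \<subseteq> shape_functional ` A" "S = (SUP i. f i)"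
      unfolding S_def using ennreal_Sup_countable_SUP[of "shape_functional ` A"] by blast
    have flim: "f \<longlonglongrightarrow> S" unfolding f(3) by (rule LIMSEQ_SUP[OF f(1)])
    then have "\<forall>\<^sub>F k in sequentially. ennreal S0 < f k" using S0 by (intro order_tendstoD)
    then obtain N where N: "\<And>k. k \<ge> N \<Longrightarrow> ennreal S0 < f k" by (auto simp: eventually_sequentially)
    have "\<exists>E. open E \<and> convex E \<and> E \<subseteq> cball 0 1 \<and> (\<exists>p\<in>E. \<exists>q\<in>E. dist p q \<ge> 1 / 2) \<and>
        f (k + N) \<le> shape_functional (E :: (real ^ 'n) set)" for k
    proof -
      obtain D where "D \<in> A" "f (k + N) = shape_functional D" using f(2) by blast
      then show ?thesis
        using obtain_normalized_body[OF n, of D] unfolding A_def by (metis (mono_tags, lifting) mem_Collect_eq)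
    qed
    then obtain E :: "nat \<Rightarrow> (real ^ 'n) set" where
      E: "\<And>k. open (E k)" "\<And>k. convex (E k)" "\<And>k. E k \<subseteq> cball 0 1"
        "\<And>k. \<exists>p\<in>E k. \<exists>q\<in>E k. dist p q \<ge> 1 / 2" and fE: "\<And>k. f (k + N) \<le> shape_functional (E k)"
      by metis
    have ne: "E k \<noteq> {}" for k using E(4) by blast
    have bd: "bounded (E k)" for k using E(3) bounded_cball bounded_subset by blast
    have EA: "E k \<in> A" for k using E ne bd by (simp add: A_def)
    have lim: "(\<lambda>k. shape_functional (E k)) \<longlonglongrightarrow> S"
    proof (rule tendsto_sandwich)
      show "(\<lambda>k. f (k + N)) \<longlonglongrightarrow> S" using flim by (rule LIMSEQ_ignore_initial_segment)
      show "(\<lambda>k. S) \<longlonglongrightarrow> S" by simp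
    qed (use fE le_S[OF EA] in auto)
    obtain v where v: "v > 0" "\<And>k. ennreal v \<le> emeasure lborel (E k)"
    proof -
      have "ennreal S0 \<le> shape_functional (E k)" for k
        using N[of "k + N"] fE[of k] by simp
      then show ?thesis using volume_ge_if_shape_functional_ge[OF assms S0(1)] E that by metis
    qed
    obtain K r where r: "strict_mono r" and K: "compact K" "convex K" "K \<subseteq> cball 0 1"
      and near: "\<And>\<epsilon>. \<epsilon> > 0 \<Longrightarrow> \<forall>\<^sub>F k in sequentially. \<forall>x\<in>K. infdist x (E (r k)) \<le> \<epsilon>"
      and sub: "\<And>U. open U \<Longrightarrow> K \<subseteq> U \<Longrightarrow> \<forall>\<^sub>F k in sequentially. E (r k) \<subseteq> U"
      by (rule Blaschke_selection[of E 1, OF E(2) ne E(3)]) blast+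
    have int: "interior K \<noteq> {}"
      by (rule interior_nonempty_of_limit[of K v "\<lambda>k. E (r k)"]) (fact K v E sub)+
    have "S \<le> shape_functional (interior K)"
    proof (rule shape_functional_upper_semicontinuous[of "\<lambda>k. E (r k)"])
      show "(\<lambda>k. shape_functional (E (r k))) \<longlonglongrightarrow> S"
        using LIMSEQ_subseq_LIMSEQ[OF lim r] by (simp add: o_def)
    qed (fact n E ne bd K int near sub)+
    moreover have "interior K \<in> A"
      using K int by (auto simp: A_def convex_interior bounded_interior compact_imp_bounded)
    ultimately show ?thesis by blast
  qed
  then obtain K where K: "K \<in> A" "S \<le> shape_functional K" by blast
  then have "S = shape_functional K" using le_S by (intro antisym)
  then show ?thesis
    using K(1) unfolding S_def A_def by (intro exI[of _ K]) (auto simp: interior_open)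
qed

end
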